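(* Let $m$ and $r$ be positive integers and let $0 < k_1 < \cdots < k_r < n$ be integers; set $k_{r+1} = n$. If $k_i \geq (m-1)k_{i-1}$ for all $2 \leq i \leq r+1$, then the diagonal action of $\mathbb{P}GL(n)$ on $F(k_1, \dots, k_r; n)^m$ is dense.
   Context: Work over an algebraically closed field. For integers $0 < k_1 < \cdots < k_r < n$ and an $n$-dimensional vector space $V$, $F(k_1, \dots, k_r; n)$ denotes the partial flag variety parameterizing flags $W_{k_1} \subset \cdots \subset W_{k_r} \subset V$ of linear subspaces with $\dim W_{k_i} = k_i$. The group $\mathbb{P}GL(n) = \mathbb{P}GL(V)$ acts on $F(k_1,\dots,k_r;n)$ and hence diagonally on the $m$-fold self-product $F(k_1,\dots,k_r;n)^m$. The action is called dense if it has a (Zariski) dense orbit. *)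

theory Defs
  imports
    "HOL-Analysis.Abstract_Topology"
    "HOL-Algebra.Group_Action"
    "HOL-Library.Poly_Mapping"
    "Jordan_Normal_Form.VS_Connect"
    "Jordan_Normal_Form.DL_Submatrix"
begin

text \<open>
  The ambient space is \<open>V = K\<^sup>n\<close>, with vectors and matrices indexed from \<open>0\<close>. The members of a
  flag are indexed by \<open>{1..r}\<close> and the factors of a self-product by \<open>{1..m}\<close>.
\<close>

abbreviation subspace_of_dim :: "nat \<Rightarrow> nat \<Rightarrow> 'k::field vec set \<Rightarrow> bool" where
  "subspace_of_dim n d W \<equiv>
     VectorSpace.subspace class_ring W (module_vec TYPE('k) n) \<and>
     vectorspace.dim class_ring ((module_vec TYPE('k) n)\<lparr>carrier := W\<rparr>) = d"

definition flag_variety :: "nat \<Rightarrow> nat \<Rightarrow> (nat \<Rightarrow> nat) \<Rightarrow> (nat \<Rightarrow> 'k::field vec set) set" where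
  "flag_variety n r k =
     {W \<in> extensional {1..r}.
        (\<forall>i\<in>{1..r}. subspace_of_dim n (k i) (W i)) \<and>
        (\<forall>i\<in>{1..<r}. W i \<subseteq> W (Suc i))}"

definition flag_power ::
    "nat \<Rightarrow> nat \<Rightarrow> (nat \<Rightarrow> nat) \<Rightarrow> nat \<Rightarrow> (nat \<Rightarrow> nat \<Rightarrow> 'k::field vec set) set" where
  "flag_power n r k m = {1..m} \<rightarrow>\<^sub>E flag_variety n r k"


section \<open>The projective linear group and its diagonal action\<close>

definition GL :: "'k::field itself \<Rightarrow> nat \<Rightarrow> 'k mat monoid" where
  "GL ty n = units_of (ring_mat ty n ())"

definition PGL :: "'k::field itself \<Rightarrow> nat \<Rightarrow> 'k mat set monoid" where
  "PGL ty n = GL ty n Mod {c \<cdot>\<^sub>m 1\<^sub>m n | c. c \<noteq> 0}"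

text \<open>
  An element of \<open>PGL\<close> is a coset \<open>g = {c A | c \<noteq> 0}\<close>. All its representatives map a subspace \<open>W\<close> to
  the same subspace \<open>A W\<close>, so the union below is just \<open>A W\<close>.
\<close>
definition pgl_image :: "'k::field mat set \<Rightarrow> 'k vec set \<Rightarrow> 'k vec set" where
  "pgl_image g W = (\<Union>A\<in>g. (\<lambda>v. A *\<^sub>v v) ` W)"

definition diagonal_action ::
    "nat \<Rightarrow> nat \<Rightarrow> (nat \<Rightarrow> nat) \<Rightarrow> nat \<Rightarrow> 'k::field mat set
     \<Rightarrow> (nat \<Rightarrow> nat \<Rightarrow> 'k vec set) \<Rightarrow> (nat \<Rightarrow> nat \<Rightarrow> 'k vec set)" where
  "diagonal_action n r k m g =
     (\<lambda>F\<in>flag_power n r k m. \<lambda>j\<in>{1..m}. \<lambda>i\<in>{1..r}. pgl_image g (F j i))"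


section \<open>The Zariski topology\<close>

text \<open>
  The product of flag varieties is regarded as a projective variety via the Pluecker embedding
  into the product, over \<open>j \<in> {1..m}\<close> and \<open>i \<in> {1..r}\<close>, of the projective spaces of the \<open>k i\<close>-th
  exterior powers of \<open>V\<close>. The homogeneous coordinates on the factor \<open>(j, i)\<close> are indexed by the
  \<open>k i\<close>-element subsets \<open>S\<close> of \<open>{..<n}\<close>. Polynomials in all these coordinates are finitely supported
  maps from monomials to coefficients, a monomial being a finitely supported exponent function.
\<close>

type_synonym plucker_index = "nat \<times> nat \<times> nat set"
type_synonym 'k plucker_poly = "(plucker_index \<Rightarrow>\<^sub>0 nat) \<Rightarrow>\<^sub>0 'k"

definition plucker_eval :: "'k::field plucker_poly \<Rightarrow> (plucker_index \<Rightarrow> 'k) \<Rightarrow> 'k" where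
  "plucker_eval p x =
     (\<Sum>\<mu>\<in>Poly_Mapping.keys p. Poly_Mapping.lookup p \<mu> *
        (\<Prod>v\<in>Poly_Mapping.keys \<mu>. x v ^ Poly_Mapping.lookup \<mu> v))"

definition plucker_indices :: "nat \<Rightarrow> nat \<Rightarrow> (nat \<Rightarrow> nat) \<Rightarrow> nat \<Rightarrow> plucker_index set" where
  "plucker_indices n r k m =
     {(j, i, S). j \<in> {1..m} \<and> i \<in> {1..r} \<and> S \<subseteq> {..<n} \<and> card S = k i}"

definition multihomogeneous ::
    "nat \<Rightarrow> nat \<Rightarrow> (nat \<Rightarrow> nat) \<Rightarrow> nat \<Rightarrow> 'k::field plucker_poly \<Rightarrow> bool" where
  "multihomogeneous n r k m p \<longleftrightarrow>
     (\<exists>d. \<forall>\<mu>\<in>Poly_Mapping.keys p.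
        Poly_Mapping.keys \<mu> \<subseteq> plucker_indices n r k m \<and>
        (\<forall>j\<in>{1..m}. \<forall>i\<in>{1..r}.
           (\<Sum>S | S \<subseteq> {..<n} \<and> card S = k i. Poly_Mapping.lookup \<mu> (j, i, S)) = d j i))"

definition is_basis_of :: "nat \<Rightarrow> 'k::field vec set \<Rightarrow> 'k vec list \<Rightarrow> bool" where
  "is_basis_of n W bs \<longleftrightarrow>
     distinct bs \<and>
     vectorspace.basis class_ring ((module_vec TYPE('k) n)\<lparr>carrier := W\<rparr>) (set bs)"

text \<open>
  Given a basis \<open>b j i\<close> of each subspace \<open>F j i\<close>, the \<open>(j, i, S)\<close> coordinate is the maximal minor of
  the matrix with columns \<open>b j i\<close> on the rows in \<open>S\<close>. Changing the basis \<open>b j i\<close> multiplies all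
  coordinates in the factor \<open>(j, i)\<close> by one common nonzero scalar.
\<close>
definition plucker_coords ::
    "nat \<Rightarrow> (nat \<Rightarrow> nat \<Rightarrow> 'k::field vec list) \<Rightarrow> plucker_index \<Rightarrow> 'k" where
  "plucker_coords n b = (\<lambda>(j, i, S). det (submatrix (mat_of_cols n (b j i)) S UNIV))"

definition plucker_zero_locus ::
    "nat \<Rightarrow> nat \<Rightarrow> (nat \<Rightarrow> nat) \<Rightarrow> nat \<Rightarrow> 'k::field plucker_poly
     \<Rightarrow> (nat \<Rightarrow> nat \<Rightarrow> 'k vec set) set" where
  "plucker_zero_locus n r k m p =
     {F \<in> flag_power n r k m.
        \<forall>b. (\<forall>j\<in>{1..m}. \<forall>i\<in>{1..r}. is_basis_of n (F j i) (b j i))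
          \<longrightarrow> plucker_eval p (plucker_coords n b) = 0}"

text \<open>
  The Zariski topology: the closed sets are the intersections of zero loci of multihomogeneous
  polynomials. The generating open sets are closed under finite intersections, because the product
  of two multihomogeneous polynomials is multihomogeneous, so they form a base; the constant
  polynomial \<open>1\<close> gives the whole space.
\<close>
definition zariski ::
    "nat \<Rightarrow> nat \<Rightarrow> (nat \<Rightarrow> nat) \<Rightarrow> nat \<Rightarrow> (nat \<Rightarrow> nat \<Rightarrow> 'k::field vec set) topology" where
  "zariski n r k m =
     topology_generated_by
       {flag_power n r k m - plucker_zero_locus n r k m p | p. multihomogeneous n r k m p}"


section \<open>Dense actions\<close>

definition dense_action ::
    "('g, 'b) monoid_scheme \<Rightarrow> ('g \<Rightarrow> 'x \<Rightarrow> 'x) \<Rightarrow> 'x topology \<Rightarrow> 'x set \<Rightarrow> bool" where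
  "dense_action G \<phi> T X \<longleftrightarrow> (\<exists>x\<in>X. T closure_of (orbit G \<phi> x) = X)"

end

(*
  Choose coordinates so that a tuple of flags is a tuple of invertible matrices g_1, ..., g_m, the
  i-th member of the j-th flag being the span of the first k_i columns of g_j. If the first m - 1
  subspaces of dimension k_r and the first c = n - (m - 1) k_r columns of g_m form a basis of V,
  then the remaining s = k_r - c columns of g_m are described in this basis by s x s blocks
  C_1, ..., C_{m-1}. The residual group acts on them by C_j -> L_j C_j R with L_j, R in the
  parabolic subgroup of GL(s) of type (k_1 - c, ..., k_{r-1} - c), and writing C_j as
  h_j^{-1} h_m this is again the problem for m-tuples of flags, now in a space of dimension s.
  The hypothesis k_i >= (m - 1) k_{i-1} survives this step, so induction on r yields a tuple h such
  that every rational curve through h stays in the orbit of h for almost all parameters. Density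
  follows by joining an arbitrary tuple g to h by a line: almost all of its points lie in a
  given open neighbourhood of g and in the orbit of h.
*)

theory Submission
  imports Defs
begin

section \<open>Regular rational curves of matrices\<close>

text \<open>Curves replace openness of orbits, dimension counts and irreducibility. This is why the
  curves are not merely polynomial. Every condition met at \<open>0\<close>, be it an invertible
  determinant or a nonvanishing polynomial in Pluecker coordinates, then fails for only finitely
  many parameters. Finitely many such conditions therefore hold simultaneously somewhere, because an
  algebraically closed field is infinite. The induction cannot keep the dimensions strictly
  increasing: subtracting c may push several of them to 0. It therefore runs over weakly increasing
  dimensions with truncated subtraction, and this also covers the degenerate case c \<ge> k_r, where
  the remaining space is 0.\<close>

definition regular_rational :: "('k::field \<Rightarrow> 'k) \<Rightarrow> bool" where
  "regular_rational f \<longleftrightarrow>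
     (\<exists>p q. poly q 0 \<noteq> 0 \<and> (\<forall>t. poly q t \<noteq> 0 \<longrightarrow> f t * poly q t = poly p t))"

lemma regular_rationalI:
  assumes "poly q 0 \<noteq> 0" "\<And>t. poly q t \<noteq> 0 \<Longrightarrow> f t * poly q t = poly p t"
  shows "regular_rational f"
  using assms unfolding regular_rational_def by blast

lemma regular_rational_const: "regular_rational (\<lambda>t. c)"
  by (rule regular_rationalI[of 1 _ "[:c:]"]) auto

lemma regular_rational_id: "regular_rational (\<lambda>t. t)"
  by (rule regular_rationalI[of 1 _ "[:0, 1:]"]) auto

lemma regular_rational_add:
  assumes "regular_rational f" "regular_rational g"
  shows "regular_rational (\<lambda>t. f t + g t)"
proof -
  obtain p q where f: "poly q 0 \<noteq> 0" "\<And>t. poly q t \<noteq> 0 \<Longrightarrow> f t * poly q t = poly p t"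
    using assms(1) unfolding regular_rational_def by blast
  obtain p' q' where g: "poly q' 0 \<noteq> 0" "\<And>t. poly q' t \<noteq> 0 \<Longrightarrow> g t * poly q' t = poly p' t"
    using assms(2) unfolding regular_rational_def by blast
  show ?thesis
  proof (rule regular_rationalI[of "q * q'" _ "p * q' + p' * q"])
    fix t assume "poly (q * q') t \<noteq> 0"
    then have "f t * poly q t = poly p t" "g t * poly q' t = poly p' t"
      using f g by auto
    then show "(f t + g t) * poly (q * q') t = poly (p * q' + p' * q) t"
      by (simp flip: \<open>f t * poly q t = _\<close> \<open>g t * poly q' t = _\<close>) (simp add: algebra_simps)
  qed (use f g in auto)
qed

lemma regular_rational_mult:
  assumes "regular_rational f" "regular_rational g"
  shows "regular_rational (\<lambda>t. f t * g t)"
proof -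
  obtain p q where f: "poly q 0 \<noteq> 0" "\<And>t. poly q t \<noteq> 0 \<Longrightarrow> f t * poly q t = poly p t"
    using assms(1) unfolding regular_rational_def by blast
  obtain p' q' where g: "poly q' 0 \<noteq> 0" "\<And>t. poly q' t \<noteq> 0 \<Longrightarrow> g t * poly q' t = poly p' t"
    using assms(2) unfolding regular_rational_def by blast
  show ?thesis
  proof (rule regular_rationalI[of "q * q'" _ "p * p'"])
    fix t assume "poly (q * q') t \<noteq> 0"
    then have "f t * poly q t = poly p t" "g t * poly q' t = poly p' t"
      using f g by auto
    then show "(f t * g t) * poly (q * q') t = poly (p * p') t"
      by (simp flip: \<open>f t * poly q t = _\<close> \<open>g t * poly q' t = _\<close>) 
  qed (use f g in auto)
qed

text \<open>The defining identity is only demanded off the zeros of the denominator. Multiplying the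
  new denominator \<open>p\<close> by \<open>q\<close> therefore discards both the parameters where
  \<open>f\<close> is arbitrary and those where \<open>f\<close> vanishes and the inverse is a
  default value.\<close>

lemma regular_rational_inverse:
  assumes "regular_rational f" "f 0 \<noteq> 0"
  shows "regular_rational (\<lambda>t. inverse (f t))"
proof -
  obtain p q where f: "poly q 0 \<noteq> 0" "\<And>t. poly q t \<noteq> 0 \<Longrightarrow> f t * poly q t = poly p t"
    using assms(1) unfolding regular_rational_def by blast
  show ?thesis
  proof (rule regular_rationalI[of "p * q" _ "q * q"])
    have "poly p 0 \<noteq> 0"
      using f(2)[of 0] f(1) assms(2) by auto
    then show "poly (p * q) 0 \<noteq> 0"
      using f(1) by auto
  next
    fix t assume t: "poly (p * q) t \<noteq> 0"
    then have *: "f t * poly q t = poly p t"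
      using f by auto
    with t have "f t \<noteq> 0" by auto
    then show "inverse (f t) * poly (p * q) t = poly (q * q) t"
      by (simp flip: *)
  qed
qed

lemma regular_rational_sum:
  "(\<And>i. i \<in> I \<Longrightarrow> regular_rational (f i)) \<Longrightarrow> regular_rational (\<lambda>t. \<Sum>i\<in>I. f i t)"
  by (induction I rule: infinite_finite_induct)
    (auto intro: regular_rational_const regular_rational_add)

lemma regular_rational_prod:
  "(\<And>i. i \<in> I \<Longrightarrow> regular_rational (f i)) \<Longrightarrow> regular_rational (\<lambda>t. \<Prod>i\<in>I. f i t)"
  by (induction I rule: infinite_finite_induct)
    (auto intro: regular_rational_const regular_rational_mult)

lemma regular_rational_power: "regular_rational f \<Longrightarrow> regular_rational (\<lambda>t. f t ^ e)"
  by (induction e) (auto intro: regular_rational_const regular_rational_mult)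

text \<open>A zero of \<open>f\<close> is a root of \<open>p\<close> or a point where
  \<open>q\<close> vanishes, and \<open>p * q\<close> is a nonzero polynomial because it does not
  vanish at \<open>0\<close>.\<close>

lemma regular_rational_eventually_nonzero:
  fixes f :: "'k::field \<Rightarrow> 'k"
  assumes "regular_rational f" "f 0 \<noteq> 0"
  shows "\<forall>\<^sub>F t in cofinite. f t \<noteq> 0"
proof -
  obtain p q where f: "poly q 0 \<noteq> 0" "\<And>t. poly q t \<noteq> 0 \<Longrightarrow> f t * poly q t = poly p t"
    using assms(1) unfolding regular_rational_def by blast
  then have "poly p 0 \<noteq> 0"
    using f(2)[of 0] assms(2) by (metis mult_eq_0_iff)
  with f(1) have "p * q \<noteq> 0" by auto
  then have "finite {t. poly (p * q) t = 0}"
    by (rule poly_roots_finite)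
  moreover have "{t. f t = 0} \<subseteq> {t. poly (p * q) t = 0}"
    using f(2) by force
  ultimately show ?thesis
    by (auto simp: eventually_cofinite dest: finite_subset)
qed

section \<open>Matrices depending rationally on a parameter\<close>

definition regular_mat_curve :: "nat \<Rightarrow> nat \<Rightarrow> ('k::field \<Rightarrow> 'k mat) \<Rightarrow> bool" where
  "regular_mat_curve nr nc \<gamma> \<longleftrightarrow>
     (\<forall>t. \<gamma> t \<in> carrier_mat nr nc) \<and>
     (\<forall>i<nr. \<forall>j<nc. regular_rational (\<lambda>t. \<gamma> t $$ (i, j)))"

lemma regular_mat_curve_carrier: "regular_mat_curve nr nc \<gamma> \<Longrightarrow> \<gamma> t \<in> carrier_mat nr nc"
  by (simp add: regular_mat_curve_def)

lemma regular_mat_curve_index: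
  "regular_mat_curve nr nc \<gamma> \<Longrightarrow> i < nr \<Longrightarrow> j < nc \<Longrightarrow> regular_rational (\<lambda>t. \<gamma> t $$ (i, j))"
  by (simp add: regular_mat_curve_def)

lemma regular_mat_curve_mat:
  assumes "\<And>i j. i < nr \<Longrightarrow> j < nc \<Longrightarrow> regular_rational (\<lambda>t. f t (i, j))"
  shows "regular_mat_curve nr nc (\<lambda>t. mat nr nc (f t))"
  using assms by (auto simp: regular_mat_curve_def)

lemma regular_mat_curve_const: "A \<in> carrier_mat nr nc \<Longrightarrow> regular_mat_curve nr nc (\<lambda>t. A)"
  by (auto simp: regular_mat_curve_def regular_rational_const)

lemma regular_mat_curve_mult:
  assumes "regular_mat_curve nr n \<gamma>" "regular_mat_curve n nc \<delta>"
  shows "regular_mat_curve nr nc (\<lambda>t. \<gamma> t * \<delta> t)"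
proof -
  have "(\<gamma> t * \<delta> t) $$ (i, j) = (\<Sum>l<n. \<gamma> t $$ (i, l) * \<delta> t $$ (l, j))"
    if "i < nr" "j < nc" for i j t
    using that assms[THEN regular_mat_curve_carrier, of t]
    by (auto simp: times_mat_def scalar_prod_def lessThan_atLeast0)
  then show ?thesis
    using assms
    by (auto simp: regular_mat_curve_def
        intro!: regular_rational_sum regular_rational_mult mult_carrier_mat)
qed

lemma regular_rational_det:
  assumes "regular_mat_curve n n \<gamma>"
  shows "regular_rational (\<lambda>t. det (\<gamma> t))"
proof -
  have "det (\<gamma> t) = (\<Sum>p | p permutes {0..<n}. signof p * (\<Prod>i = 0..<n. \<gamma> t $$ (i, p i)))" for t
    by (rule det_def'[OF regular_mat_curve_carrier[OF assms]])
  moreover have "p i < n" if "p permutes {0..<n}" "i < n" for p i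
    using that permutes_in_image[of p "{0..<n}" i] by simp
  ultimately show ?thesis
    using assms by (auto simp: regular_mat_curve_def
        intro!: regular_rational_sum regular_rational_mult regular_rational_prod
          regular_rational_const)
qed

text \<open>The inverse is a junk value when \<open>det A = 0\<close>.\<close>
definition mat_inv :: "'k::field mat \<Rightarrow> 'k mat" where
  "mat_inv A = inverse (det A) \<cdot>\<^sub>m adj_mat A"

lemma mat_inv_carrier [simp]: "A \<in> carrier_mat n n \<Longrightarrow> mat_inv A \<in> carrier_mat n n"
  using adj_mat[of A n] by (simp add: mat_inv_def)

lemma mat_inv:
  assumes "A \<in> carrier_mat n n" "det A \<noteq> 0"
  shows "A * mat_inv A = 1\<^sub>m n" "mat_inv A * A = 1\<^sub>m n"
proof -
  note adj = adj_mat[OF assms(1)]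
  show "A * mat_inv A = 1\<^sub>m n"
    using assms(2) adj by (auto simp: mat_inv_def mult_smult_distrib[OF assms(1) adj(1)])
  show "mat_inv A * A = 1\<^sub>m n"
    using assms(2) adj by (auto simp: mat_inv_def mult_smult_assoc_mat[OF adj(1) assms(1)])
qed

lemma det_mat_inv:
  assumes "A \<in> carrier_mat n n" "det A \<noteq> 0"
  shows "det (mat_inv A) \<noteq> 0"
proof -
  have "det A * det (mat_inv A) = 1"
    using mat_inv(1)[OF assms] det_mult[OF assms(1) mat_inv_carrier[OF assms(1)]] by simp
  then show ?thesis by auto
qed

lemma mat_inv_unique:
  assumes "A \<in> carrier_mat n n" "B \<in> carrier_mat n n" "A * B = 1\<^sub>m n"
  shows "mat_inv A = B"
proof -
  have "det A * det B = 1"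
    using assms det_mult[OF assms(1,2)] by simp
  then have A: "det A \<noteq> 0" by auto
  have "mat_inv A * (A * B) = mat_inv A * A * B"
    using assms by (intro assoc_mult_mat[of _ n n _ n _ n, symmetric]) auto
  also have "\<dots> = B"
    using assms mat_inv(2)[OF assms(1) A] by simp
  finally show ?thesis
    using assms mat_inv_carrier[OF assms(1)] by simp
qed

text \<open>Cramer's rule: the cofactors are determinants of submatrices, and the inverse of the
  determinant is regular since the determinant is nonzero at \<open>0\<close>.\<close>

lemma regular_mat_curve_inv:
  assumes "regular_mat_curve n n \<gamma>" "det (\<gamma> 0) \<noteq> 0"
  shows "regular_mat_curve n n (\<lambda>t. mat_inv (\<gamma> t))"
proof -
  have car: "\<gamma> t \<in> carrier_mat n n" for t
    by (rule regular_mat_curve_carrier[OF assms(1)])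
  have ins: "insert_index a i < n" if "i < n - 1" for a i
    using that by (auto simp: insert_index_def)
  have "regular_mat_curve (n - 1) (n - 1) (\<lambda>t. mat_delete (\<gamma> t) i j)" if "i < n" "j < n" for i j
    unfolding regular_mat_curve_def
  proof (intro conjI allI impI)
    show "mat_delete (\<gamma> t) i j \<in> carrier_mat (n - 1) (n - 1)" for t
      using mat_delete_carrier[OF car] .
    fix a b assume ab: "a < n - 1" "b < n - 1"
    then have "mat_delete (\<gamma> t) i j $$ (a, b) = \<gamma> t $$ (insert_index i a, insert_index j b)" for t
      using mat_delete_index[of "\<gamma> t" "n - 1" i j a b] car[of t] that by auto
    then show "regular_rational (\<lambda>t. mat_delete (\<gamma> t) i j $$ (a, b))"
      using assms(1) ins ab by (simp add: regular_mat_curve_def)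
  qed
  then have cof: "regular_rational (\<lambda>t. cofactor (\<gamma> t) i j)" if "i < n" "j < n" for i j
    using that by (auto simp: cofactor_def
        intro!: regular_rational_mult regular_rational_const regular_rational_det)
  have adj: "adj_mat (\<gamma> t) $$ (i, j) = cofactor (\<gamma> t) j i" if "i < n" "j < n" for i j t
    using that car[of t] by (auto simp: adj_mat_def)
  have "regular_rational (\<lambda>t. (inverse (det (\<gamma> t)) \<cdot>\<^sub>m adj_mat (\<gamma> t)) $$ (i, j))"
    if "i < n" "j < n" for i j
  proof -
    have "(inverse (det (\<gamma> t)) \<cdot>\<^sub>m adj_mat (\<gamma> t)) $$ (i, j) = inverse (det (\<gamma> t)) * adj_mat (\<gamma> t) $$ (i, j)" for t
      using that adj_mat(1)[OF car, of t] by auto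
    with that show ?thesis
      using adj cof assms
      by (simp add: regular_rational_mult regular_rational_inverse regular_rational_det)
  qed
  then show ?thesis
    using adj_mat(1)[OF car] unfolding regular_mat_curve_def mat_inv_def
    by (intro conjI allI impI smult_carrier_mat)
qed

lemma regular_mat_curve_eventually_invertible:
  assumes "regular_mat_curve n n \<gamma>" "det (\<gamma> 0) \<noteq> 0"
  shows "\<forall>\<^sub>F t in cofinite. det (\<gamma> t) \<noteq> 0"
  using regular_rational_eventually_nonzero regular_rational_det assms by blast

section \<open>Reducing the last step of the flags\<close>

lemma sum_mat_mult_index:
  assumes "A \<in> carrier_mat nr n" "B \<in> carrier_mat n nc" "i < nr" "j < nc"
  shows "(A * B) $$ (i, j) = (\<Sum>l<n. A $$ (i, l) * B $$ (l, j))"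
  using assms by (auto simp: times_mat_def scalar_prod_def lessThan_atLeast0)

lemma sum_mult_mat_vec_index:
  assumes "A \<in> carrier_mat nr n" "v \<in> carrier_vec n" "i < nr"
  shows "(A *\<^sub>v v) $ i = (\<Sum>l<n. A $$ (i, l) * v $ l)"
  using assms by (auto simp: scalar_prod_def lessThan_atLeast0)

text \<open>Kernel vectors appear as coefficient functions, so that the block matrices below can be
  treated row by row with finite sums.\<close>

lemma det_nonzeroI:
  fixes A :: "'k::field mat"
  assumes "A \<in> carrier_mat n n"
    and "\<And>f b. (\<And>a. a < n \<Longrightarrow> (\<Sum>b<n. A $$ (a, b) * f b) = 0) \<Longrightarrow> b < n \<Longrightarrow> f b = 0"
  shows "det A \<noteq> 0"
proof
  assume "det A = 0"
  then obtain v where v: "v \<in> carrier_vec n" "v \<noteq> 0\<^sub>v n" "A *\<^sub>v v = 0\<^sub>v n"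
    using det_0_iff_vec_prod_zero[OF assms(1)] by blast
  have "(\<Sum>b<n. A $$ (a, b) * v $ b) = 0" if "a < n" for a
    using sum_mult_mat_vec_index[OF assms(1) v(1) that] v(3) that by simp
  then have "v $ b = 0" if "b < n" for b
    using assms(2)[of "\<lambda>b. v $ b"] that by blast
  with v show False by (metis eq_vecI carrier_vecD index_zero_vec)
qed

lemma det_nonzeroD:
  fixes A :: "'k::field mat"
  assumes "A \<in> carrier_mat n n" "det A \<noteq> 0"
    and "\<And>a. a < n \<Longrightarrow> (\<Sum>b<n. A $$ (a, b) * f b) = 0" and "b < n"
  shows "f b = 0"
proof -
  have "A *\<^sub>v vec n f = 0\<^sub>v n"
    using assms(1,3) by (intro eq_vecI) (auto simp: scalar_prod_def lessThan_atLeast0)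
  then have "vec n f = 0\<^sub>v n"
    using det_0_iff_vec_prod_zero[OF assms(1)] assms(2) by (metis vec_carrier)
  then show ?thesis
    using assms(4) by (metis index_vec index_zero_vec(1))
qed

text \<open>With \<open>min\<close> and truncated subtraction the split also holds for
  \<open>c > k\<close>, where the second sum is empty. This spares case distinctions on whether any
  columns remain after the reduction.\<close>

lemma sum_lessThan_split:
  fixes F :: "nat \<Rightarrow> 'a::comm_monoid_add"
  shows "(\<Sum>y<k. F y) = (\<Sum>y<min c k. F y) + (\<Sum>y<k - c. F (c + y))"
proof (cases "c \<le> k")
  case True
  have "{..<k} = {..<c} \<union> {c..<k}" using True by auto
  moreover have "sum F {c..<k} = (\<Sum>y<k - c. F (c + y))"
    using True sum.shift_bounds_nat_ivl[of F 0 c "k - c"]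
    by (simp add: add.commute lessThan_atLeast0)
  ultimately show ?thesis using True by (simp add: sum.union_disjoint ivl_disj_int)
qed (auto simp: min_def)

lemma sum_eq_term:
  fixes F :: "nat \<Rightarrow> 'a::comm_monoid_add"
  assumes "b < n" "\<And>x. x < n \<Longrightarrow> x \<noteq> b \<Longrightarrow> F x = 0"
  shows "(\<Sum>x<n. F x) = F b"
  using assms sum.mono_neutral_right[of "{..<n}" "{b}" F] by auto

section \<open>Orbits on tuples of matrices modulo parabolic subgroups\<close>

text \<open>The invertible matrices of this form are the parabolic subgroup stabilising the standard
  subspaces with dimensions in \<open>K\<close>. Members \<open>0\<close> and \<open>n\<close> of
  \<open>K\<close> impose no condition, which absorbs the dimensions that collapse in the
  induction.\<close>

definition block_upper :: "nat \<Rightarrow> nat set \<Rightarrow> 'k::field mat \<Rightarrow> bool" where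
  "block_upper n K p \<longleftrightarrow>
     p \<in> carrier_mat n n \<and> (\<forall>d\<in>K. \<forall>a<n. \<forall>b<d. d \<le> a \<longrightarrow> p $$ (a, b) = 0)"

text \<open>GL(n)-orbits on tuples of cosets of the parabolic subgroup, written without inverses.
  Once \<open>g j\<close> and \<open>h j\<close> are invertible, taking determinants in the equation
  gives invertibility of \<open>p j\<close>.\<close>

definition same_orbit ::
    "nat \<Rightarrow> nat set \<Rightarrow> nat \<Rightarrow> (nat \<Rightarrow> 'k::field mat) \<Rightarrow> (nat \<Rightarrow> 'k mat) \<Rightarrow> bool" where
  "same_orbit n K m g h \<longleftrightarrow>
     (\<exists>A p. A \<in> carrier_mat n n \<and> det A \<noteq> 0 \<and>
        (\<forall>j<m. block_upper n K (p j) \<and> A * g j = h j * p j))"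

text \<open>The conditions in \<open>block_upper\<close> concern columns before some member of
  \<open>K\<close>, so coefficients \<open>w\<close> for the first \<open>l\<close> columns settle
  them: since the columns of \<open>h j\<close> are independent, the corresponding columns of
  \<open>mat_inv (h j) * (A * g j)\<close> must be given by \<open>w\<close>.\<close>

lemma same_orbitI:
  assumes A: "A \<in> carrier_mat n n" "det A \<noteq> 0"
    and g: "\<And>j. j < m \<Longrightarrow> g j \<in> carrier_mat n n"
    and h: "\<And>j. j < m \<Longrightarrow> h j \<in> carrier_mat n n" "\<And>j. j < m \<Longrightarrow> det (h j) \<noteq> 0"
    and w: "\<And>j b a. j < m \<Longrightarrow> b < l \<Longrightarrow> a < n \<Longrightarrow>
             (A * g j) $$ (a, b) = (\<Sum>x<n. h j $$ (a, x) * w j b x)"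
      "\<And>j d b a. j < m \<Longrightarrow> d \<in> K \<Longrightarrow> b < d \<Longrightarrow> d \<le> a \<Longrightarrow> a < n \<Longrightarrow> w j b a = 0"
    and K: "\<And>d. d \<in> K \<Longrightarrow> d \<le> l" and l: "l \<le> n"
  shows "same_orbit n K m g h"
  unfolding same_orbit_def
proof (intro exI conjI allI impI)
  let ?p = "\<lambda>j. mat_inv (h j) * (A * g j)"
  fix j assume j: "j < m"
  note hj = h(1)[OF j] and gj = g[OF j]
  have p: "?p j \<in> carrier_mat n n"
    using A hj gj mat_inv_carrier[OF hj] by (meson mult_carrier_mat)
  have "h j * ?p j = h j * mat_inv (h j) * (A * g j)"
    using A hj gj mat_inv_carrier[OF hj]
    by (intro assoc_mult_mat[of _ n n _ n _ n, symmetric]) (auto intro: mult_carrier_mat)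
  also have "\<dots> = A * g j"
    using mat_inv(1)[OF hj h(2)[OF j]] A gj by (auto intro!: left_mult_one_mat mult_carrier_mat)
  finally show hp: "A * g j = h j * ?p j" by simp
  show "block_upper n K (?p j)"
    unfolding block_upper_def
  proof (intro conjI ballI allI impI p)
    fix d a b assume d: "d \<in> K" "a < n" "b < d" "d \<le> a"
    have b: "b < l" "b < n" using d K[OF d(1)] l by auto
    have "?p j $$ (x, b) - w j b x = 0" if x: "x < n" for x
    proof (rule det_nonzeroD[OF hj h(2)[OF j] _ x])
      fix a assume a: "a < n"
      have "(\<Sum>x<n. h j $$ (a, x) * (?p j $$ (x, b) - w j b x))
          = (h j * ?p j) $$ (a, b) - (A * g j) $$ (a, b)"
        using sum_mat_mult_index[OF hj p a b(2)] w(1)[OF j b(1) a]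
        by (simp add: sum_subtractf algebra_simps)
      then show "(\<Sum>x<n. h j $$ (a, x) * (?p j $$ (x, b) - w j b x)) = 0"
        using hp by simp
    qed
    then show "?p j $$ (a, b) = 0"
      using w(2)[OF j d(1,3,4,2)] d(2) by auto
  qed
qed (use A in auto)

text \<open>
  The reduction step for \<open>Suc l\<close> subspaces of dimension \<open>\<kappa>\<close> in a space of dimension
  \<open>n = l * \<kappa> + c\<close>: the first \<open>l\<close> of them together with the first \<open>c\<close> columns of the last one
  generically form a basis of the space. The coordinates of the remaining \<open>s\<close> columns of the last
  subspace in this basis are what is left to normalise. When \<open>c \<ge> \<kappa>\<close> nothing is left and \<open>s = 0\<close>.
\<close>
locale flag_reduction =
  fixes n l \<kappa> c s :: nat
  assumes n: "n = l * \<kappa> + c" and s: "s = \<kappa> - c" and le: "\<kappa> \<le> n"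
begin

definition frame :: "(nat \<Rightarrow> 'k::field mat) \<Rightarrow> 'k mat" where
  "frame g = mat n n (\<lambda>(a, x).
     if x < l * \<kappa> then g (x div \<kappa>) $$ (a, x mod \<kappa>) else g l $$ (a, x - l * \<kappa>))"

definition rest :: "(nat \<Rightarrow> 'k::field mat) \<Rightarrow> 'k mat" where
  "rest g = mat n s (\<lambda>(a, b). g l $$ (a, c + b))"

definition coords :: "(nat \<Rightarrow> 'k::field mat) \<Rightarrow> 'k mat" where
  "coords g = mat_inv (frame g) * rest g"

text \<open>The invariant part of the coordinates along the j-th subspace. When this block is
  invertible, the group can clear the \<open>c\<close> coordinates above it, and the coordinates
  along the \<open>c\<close> frame columns of the last matrix are absorbed by column
  operations.\<close>

definition corner :: "(nat \<Rightarrow> 'k::field mat) \<Rightarrow> nat \<Rightarrow> 'k mat" where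
  "corner g j = mat s s (\<lambda>(y, b). coords g $$ (j * \<kappa> + c + y, b))"

text \<open>For \<open>j < l\<close> this exchanges coordinate blocks 0 and \<open>j\<close>, so
  that the first \<kappa> columns span block \<open>j\<close>. For \<open>j = l\<close> the first
  \<open>c\<close> columns occupy the last \<open>c\<close> coordinates, and the columns from
  \<kappa> on are placed so as to avoid the last \<open>s\<close> coordinates of block 0, which are
  reserved for the columns carrying \<open>D\<close>.\<close>

definition base_row :: "nat \<Rightarrow> nat \<Rightarrow> nat" where
  "base_row j b =
     (if j < l then
        (if b < \<kappa> then j * \<kappa> + b else if j * \<kappa> \<le> b \<and> b < j * \<kappa> + \<kappa> then b - j * \<kappa> else b)
      else
        (if b < c then l * \<kappa> + b else if c < \<kappa> \<and> b < \<kappa> + c then b - \<kappa> else b - c))"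

text \<open>The normal form: a tuple whose frame is the identity and whose corners are the
  prescribed \<open>D\<close>. The columns from \<kappa> on complete each matrix to an invertible
  one.\<close>

definition base :: "(nat \<Rightarrow> 'k::field mat) \<Rightarrow> nat \<Rightarrow> 'k mat" where
  "base D j = mat n n (\<lambda>(a, b).
     if j = l \<and> c \<le> b \<and> b < \<kappa>
     then (if a < l * \<kappa> \<and> c \<le> a mod \<kappa> then D (a div \<kappa>) $$ (a mod \<kappa> - c, b - c) else 0)
     else of_bool (a = base_row j b))"

lemma block_index:
  assumes "x < l * \<kappa>"
  shows "x div \<kappa> < l" "x mod \<kappa> < \<kappa>"
  using assms by (auto simp: less_mult_imp_div_less) (cases "\<kappa> = 0"; simp)

lemma block_index_less: "j < l \<Longrightarrow> y < \<kappa> \<Longrightarrow> j * \<kappa> + y < l * \<kappa>"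
  using mult_le_mono1[of "Suc j" l \<kappa>] by simp

lemma corner_index_less: "j < l \<Longrightarrow> y < s \<Longrightarrow> j * \<kappa> + c + y < l * \<kappa>"
  using block_index_less[of j "c + y"] s by (simp add: add.assoc)

lemma sum_block:
  fixes F :: "nat \<Rightarrow> 'a::comm_monoid_add"
  assumes j: "j < l" and F: "\<And>x. x < n \<Longrightarrow> \<not> (x < l * \<kappa> \<and> x div \<kappa> = j) \<Longrightarrow> F x = 0"
  shows "(\<Sum>x<n. F x) = (\<Sum>y<\<kappa>. F (j * \<kappa> + y))"
proof -
  have sub: "{j * \<kappa>..<j * \<kappa> + \<kappa>} \<subseteq> {..<n}"
    using n mult_le_mono1[of "Suc j" l \<kappa>] j by auto
  have "(\<Sum>x<n. F x) = sum F {j * \<kappa>..<j * \<kappa> + \<kappa>}"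
  proof (rule sum.mono_neutral_right)
    show "\<forall>x\<in>{..<n} - {j * \<kappa>..<j * \<kappa> + \<kappa>}. F x = 0"
    proof
      fix x assume x: "x \<in> {..<n} - {j * \<kappa>..<j * \<kappa> + \<kappa>}"
      have "\<not> (x < l * \<kappa> \<and> x div \<kappa> = j)"
      proof
        assume *: "x < l * \<kappa> \<and> x div \<kappa> = j"
        then have "x = j * \<kappa> + x mod \<kappa>" by auto
        then show False
          using x * block_index(2)[of x] by (metis DiffE add_less_cancel_left atLeastLessThan_iff le_add1)
      qed
      then show "F x = 0" using F x by auto
    qed
  qed (use sub in auto)
  also have "\<dots> = (\<Sum>y<\<kappa>. F (j * \<kappa> + y))"
    using sum.shift_bounds_nat_ivl[of F 0 "j * \<kappa>" \<kappa>] by (simp add: add.commute lessThan_atLeast0)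
  finally show ?thesis .
qed

section \<open>The normal form of a tuple with given corners\<close>

lemma base_carrier [simp]: "base D j \<in> carrier_mat n n"
  by (simp add: base_def)

lemma base_row_less: "j \<le> l \<Longrightarrow> b < n \<Longrightarrow> base_row j b < n"
  using n le block_index_less[of j "b - j * \<kappa>"] block_index_less[of j b]
  by (auto simp: base_row_def)

lemma base_row_inj:
  assumes "j < l \<or> b \<notin> {c..<\<kappa>} \<and> b' \<notin> {c..<\<kappa>}" "j \<le> l" "b < n" "b' < n" "base_row j b = base_row j b'"
  shows "b = b'"
proof (cases "j < l")
  case True
  define J where "J = j * \<kappa>"
  have "J = 0 \<or> \<kappa> \<le> J" by (cases j) (auto simp: J_def)
  then show ?thesis
    using assms(5) True unfolding base_row_def J_def[symmetric] by (auto split: if_splits)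
next
  case False
  then show ?thesis
    using assms n le by (auto simp: base_row_def split: if_splits)
qed

text \<open>For \<open>j < l\<close> this is a permutation matrix. For \<open>j = l\<close> the
  coordinates of a kernel vector vanish in a definite order: the first \<open>c\<close> by the rows
  from \<open>l * \<kappa>\<close> on, where the columns carrying \<open>D\<close> are zero; the
  next \<open>s\<close> by rows \<open>c\<close> to \<kappa> - 1, where the block \<open>D 0\<close>
  is invertible; the others by their own rows.\<close>

lemma det_base:
  assumes D: "\<And>j. j < l \<Longrightarrow> D j \<in> carrier_mat s s" "\<And>j. j < l \<Longrightarrow> det (D j) \<noteq> 0"
    and j: "j \<le> l"
  shows "det (base D j) \<noteq> 0"
proof (rule det_nonzeroI[OF base_carrier])
  fix f :: "nat \<Rightarrow> 'a" and b
  assume f: "\<And>a. a < n \<Longrightarrow> (\<Sum>b<n. base D j $$ (a, b) * f b) = 0" and b: "b < n"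
  have row: "f b = 0" if b: "b < n" "j < l \<or> b \<notin> {c..<\<kappa>}"
    and z: "j < l \<or> base_row j b \<ge> l * \<kappa> \<or> (\<forall>x\<in>{c..<\<kappa>}. f x = 0)" for b
  proof -
    have "base D j $$ (base_row j b, x) * f x = 0" if x: "x < n" "x \<noteq> b" for x
    proof (cases "j = l \<and> x \<in> {c..<\<kappa>}")
      case True
      with z x base_row_less[OF j b(1)] show ?thesis by (auto simp: base_def)
    next
      case False
      then have "base_row j b \<noteq> base_row j x"
        using base_row_inj[of j b x] b x j by auto
      with x base_row_less[OF j b(1)] False show ?thesis by (auto simp: base_def)
    qed
    then have "base D j $$ (base_row j b, b) * f b = 0"
      using f[OF base_row_less[OF j b(1)]]
        sum_eq_term[of b n "\<lambda>x. base D j $$ (base_row j b, x) * f x"] b by simp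
    then show ?thesis
      using b j base_row_less[OF j b(1)] by (auto simp: base_def)
  qed
  have mid: "f x = 0" if jl: "j = l" and x: "x \<in> {c..<\<kappa>}" for x
  proof -
    \<comment> \<open>A nonempty middle range means c < \<kappa> \<le> n, so n = l * \<kappa> + c
      excludes l = 0 and the block \<open>D 0\<close> exists.\<close>
    have l: "0 < l" using x le n by (cases l) auto
    have fc: "f b = 0" if "b < c" for b
      using row[of b] that n by (auto simp: base_row_def jl)
    have "f (c + b) = 0" if b: "b < s" for b
    proof (rule det_nonzeroD[OF D(1)[OF l] D(2)[OF l] _ b])
      fix y assume y: "y < s"
      have cy: "c + y < \<kappa>" "c + y < l * \<kappa>" "c + y < n"
        using y s x l n by (auto intro: less_le_trans[of _ \<kappa>])
      have "(\<Sum>x<n. base D j $$ (c + y, x) * f x)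
          = (\<Sum>x<min \<kappa> n. base D j $$ (c + y, x) * f x)
            + (\<Sum>x<n - \<kappa>. base D j $$ (c + y, \<kappa> + x) * f (\<kappa> + x))"
        by (rule sum_lessThan_split)
      also have "(\<Sum>x<n - \<kappa>. base D j $$ (c + y, \<kappa> + x) * f (\<kappa> + x)) = 0"
      proof (intro sum.neutral ballI)
        fix x' assume "x' \<in> {..<n - \<kappa>}"
        then have x': "\<kappa> + x' < n" by auto
        have "c + y \<noteq> base_row j (\<kappa> + x')"
          using cy x' x by (auto simp: base_row_def jl)
        then show "base D j $$ (c + y, \<kappa> + x') * f (\<kappa> + x') = 0"
          using cy x' by (simp add: base_def)
      qed
      also have "min \<kappa> n = \<kappa>" using le by simp
      also have "(\<Sum>x<\<kappa>. base D j $$ (c + y, x) * f x)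
          = (\<Sum>x<min c \<kappa>. base D j $$ (c + y, x) * f x)
            + (\<Sum>x<\<kappa> - c. base D j $$ (c + y, c + x) * f (c + x))"
        by (rule sum_lessThan_split)
      also have "(\<Sum>x<min c \<kappa>. base D j $$ (c + y, x) * f x) = 0"
        using fc by (intro sum.neutral) auto
      also have "(\<Sum>x<\<kappa> - c. base D j $$ (c + y, c + x) * f (c + x))
          = (\<Sum>x<s. D 0 $$ (y, x) * f (c + x))"
        using cy le by (intro sum.cong) (auto simp: s base_def jl)
      finally show "(\<Sum>x<s. D 0 $$ (y, x) * f (c + x)) = 0"
        using f[OF cy(3)] by simp
    qed
    from this[of "x - c"] x s show ?thesis by auto
  qed
  show "f b = 0"
    using row[OF b] mid j b by (cases "j = l") auto
qed

lemma frame_carrier [simp]: "frame g \<in> carrier_mat n n"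
  by (simp add: frame_def)

lemma rest_carrier [simp]: "rest g \<in> carrier_mat n s"
  by (simp add: rest_def)

lemma coords_carrier [simp]: "coords g \<in> carrier_mat n s"
  unfolding coords_def by (rule mult_carrier_mat[OF mat_inv_carrier[OF frame_carrier] rest_carrier])

lemma corner_carrier [simp]: "corner g j \<in> carrier_mat s s"
  by (simp add: corner_def)

lemma frame_base: "frame (base D) = 1\<^sub>m n"
proof (rule eq_matI)
  fix a x assume "a < dim_row (1\<^sub>m n :: 'a mat)" "x < dim_col (1\<^sub>m n :: 'a mat)"
  then have ax: "a < n" "x < n" by auto
  show "frame (base D) $$ (a, x) = 1\<^sub>m n $$ (a, x)"
  proof (cases "x < l * \<kappa>")
    case True
    then show ?thesis
      using ax block_index[OF True] le by (auto simp: frame_def base_def base_row_def)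
  next
    case False
    moreover have "x - l * \<kappa> < c" "x - l * \<kappa> < n" using ax n False by linarith+
    ultimately show ?thesis
      using ax by (auto simp: frame_def base_def base_row_def)
  qed
qed (auto simp: frame_def)

lemma corner_base:
  assumes "D j \<in> carrier_mat s s" "j < l"
  shows "corner (base D) j = D j"
proof (rule eq_matI)
  have inv1: "mat_inv (1\<^sub>m n) = (1\<^sub>m n :: 'a mat)"
    by (rule mat_inv_unique[of _ n]) auto
  have co: "coords (base D) = rest (base D)"
    by (simp add: coords_def frame_base inv1 left_mult_one_mat[OF rest_carrier])
  fix y b assume "y < dim_row (D j)" "b < dim_col (D j)"
  then have yb: "y < s" "b < s" using assms by auto
  have *: "j * \<kappa> + c + y < l * \<kappa>" "c + y < \<kappa>" "c + b < \<kappa>"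
    using corner_index_less[OF assms(2) yb(1)] yb s by auto
  have "(j * \<kappa> + (c + y)) div \<kappa> = j" "(j * \<kappa> + (c + y)) mod \<kappa> = c + y"
    using *(2) by auto
  moreover have "j * \<kappa> + c + y < n" "c + b < n" using * n le by linarith+
  ultimately show "corner (base D) j $$ (y, b) = D j $$ (y, b)"
    using yb * by (simp add: corner_def co rest_def base_def add.assoc)
qed (use assms in \<open>auto simp: corner_def\<close>)

section \<open>The residual group and the reduction to corners\<close>

text \<open>Block diagonal: for each \<open>j < l\<close> a block of size \<kappa> with rows (1,
  \<open>U j\<close>) and (0, \<open>P j\<close>), then an identity of size \<open>c\<close>. It
  fixes the \<open>c\<close> extra basis vectors and, when the \<open>P j\<close> are invertible,
  stabilises the first \<open>l\<close> coordinate blocks.\<close>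

definition glue :: "(nat \<Rightarrow> 'k::field mat) \<Rightarrow> (nat \<Rightarrow> 'k mat) \<Rightarrow> 'k mat" where
  "glue U P = mat n n (\<lambda>(x, x').
     if x < l * \<kappa> then
       (if x' < l * \<kappa> \<and> x' div \<kappa> = x div \<kappa> then
          (if x mod \<kappa> < c then
             (if x' mod \<kappa> < c then of_bool (x = x') else U (x div \<kappa>) $$ (x mod \<kappa>, x' mod \<kappa> - c))
           else
             (if x' mod \<kappa> < c then 0 else P (x div \<kappa>) $$ (x mod \<kappa> - c, x' mod \<kappa> - c)))
        else 0)
     else of_bool (x = x'))"

lemma glue_carrier [simp]: "glue U P \<in> carrier_mat n n"
  by (simp add: glue_def)

lemma glue_sum:
  assumes x: "x < n"
  shows "(\<Sum>x'<n. glue U P $$ (x, x') * f x') =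
    (if x < l * \<kappa> then
       (if x mod \<kappa> < c
        then f x + (\<Sum>y<s. U (x div \<kappa>) $$ (x mod \<kappa>, y) * f (x div \<kappa> * \<kappa> + c + y))
        else (\<Sum>y<s. P (x div \<kappa>) $$ (x mod \<kappa> - c, y) * f (x div \<kappa> * \<kappa> + c + y)))
     else f x)"
proof (cases "x < l * \<kappa>")
  case False
  then show ?thesis
    using x sum_eq_term[OF x, of "\<lambda>x'. glue U P $$ (x, x') * f x'"] by (simp add: glue_def)
next
  case True
  define j where "j = x div \<kappa>"
  have j: "j < l" and r: "x mod \<kappa> < \<kappa>" and xj: "x = j * \<kappa> + x mod \<kappa>"
    using block_index[OF True] by (auto simp: j_def)
  define F where "F = (\<lambda>x'. glue U P $$ (x, x') * f x')"
  have idx: "(j * \<kappa> + y) div \<kappa> = j" "(j * \<kappa> + y) mod \<kappa> = y" "j * \<kappa> + y < l * \<kappa>" "j * \<kappa> + y < n"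
    if "y < \<kappa>" for y
    using that block_index_less[OF j that] n by auto
  have "(\<Sum>x'<n. F x') = (\<Sum>y<\<kappa>. F (j * \<kappa> + y))"
    by (rule sum_block[OF j]) (use x True in \<open>auto simp: F_def glue_def j_def\<close>)
  also have "\<dots> = (\<Sum>y<min c \<kappa>. F (j * \<kappa> + y)) + (\<Sum>y<s. F (j * \<kappa> + (c + y)))"
    unfolding s by (rule sum_lessThan_split)
  also have "(\<Sum>y<s. F (j * \<kappa> + (c + y))) =
      (\<Sum>y<s. (if x mod \<kappa> < c then U j $$ (x mod \<kappa>, y) else P j $$ (x mod \<kappa> - c, y))
         * f (j * \<kappa> + c + y))"
    using x True s idx by (intro sum.cong) (auto simp: F_def glue_def j_def add.assoc)
  also have "(\<Sum>y<min c \<kappa>. F (j * \<kappa> + y)) = (if x mod \<kappa> < c then f x else 0)"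
  proof (cases "x mod \<kappa> < c")
    case c: True
    have "(\<Sum>y<min c \<kappa>. F (j * \<kappa> + y)) = F (j * \<kappa> + x mod \<kappa>)"
    proof (rule sum_eq_term)
      fix y assume y: "y < min c \<kappa>" "y \<noteq> x mod \<kappa>"
      then have "x \<noteq> j * \<kappa> + y" using idx(2)[of y] by auto
      then show "F (j * \<kappa> + y) = 0"
        using y c x True idx[of y] by (simp add: F_def glue_def j_def)
    qed (use c r in auto)
    also have "\<dots> = f x"
      using c x True by (simp add: F_def glue_def flip: xj)
    finally show ?thesis using c by simp
  next
    case False
    then show ?thesis
      using x True idx by (auto simp: F_def glue_def j_def intro!: sum.neutral)
  qed
  finally show ?thesis
    using True by (auto simp: F_def j_def)
qed

lemma det_glue:
  assumes "\<And>j. j < l \<Longrightarrow> P j \<in> carrier_mat s s" "\<And>j. j < l \<Longrightarrow> det (P j) \<noteq> 0"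
  shows "det (glue U P) \<noteq> 0"
proof (rule det_nonzeroI[OF glue_carrier])
  fix f :: "nat \<Rightarrow> 'a" and x
  assume f: "\<And>x. x < n \<Longrightarrow> (\<Sum>x'<n. glue U P $$ (x, x') * f x') = 0" and x: "x < n"
  have low: "f (j * \<kappa> + c + y) = 0" if j: "j < l" and y: "y < s" for j y
  proof (rule det_nonzeroD[OF assms(1)[OF j] assms(2)[OF j] _ y])
    fix y assume y: "y < s"
    have idx: "(j * \<kappa> + (c + y)) div \<kappa> = j" "(j * \<kappa> + (c + y)) mod \<kappa> = c + y"
      using y s by auto
    then show "(\<Sum>b<s. P j $$ (y, b) * f (j * \<kappa> + c + b)) = 0"
      using f[of "j * \<kappa> + c + y"] glue_sum[of "j * \<kappa> + c + y" U P f] n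
        corner_index_less[OF j y]
      by (simp add: add.assoc)
  qed
  show "f x = 0"
  proof (cases "x < l * \<kappa> \<and> c \<le> x mod \<kappa>")
    case True
    then show ?thesis
      using low[of "x div \<kappa>" "x mod \<kappa> - c"] block_index[of x] s by auto
  next
    case False
    then show ?thesis
      using f[OF x] low block_index[of x] by (auto simp: glue_sum[OF x] split: if_splits)
  qed
qed

text \<open>The matrix \<open>A\<close> first makes the frame the identity and then acts by
  \<open>glue\<close>. The choice U = - T C^-1 cancels the upper \<open>c\<close> coordinates T in
  each block, while \<open>P j\<close> turns the corner C into \<open>D j * R\<close>, which is what
  the column operation \<open>R\<close> produces from the normal form.\<close>

lemma same_orbit_base:
  fixes g D :: "nat \<Rightarrow> 'k::field mat"
  assumes g: "\<And>j. j \<le> l \<Longrightarrow> g j \<in> carrier_mat n n" "det (frame g) \<noteq> 0"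
      "\<And>j. j < l \<Longrightarrow> det (corner g j) \<noteq> 0"
    and D: "\<And>j. j < l \<Longrightarrow> D j \<in> carrier_mat s s" "\<And>j. j < l \<Longrightarrow> det (D j) \<noteq> 0"
    and P: "\<And>j. j < l \<Longrightarrow> block_upper s K' (P j)" "\<And>j. j < l \<Longrightarrow> det (P j) \<noteq> 0"
    and R: "block_upper s K' R"
    and eq: "\<And>j. j < l \<Longrightarrow> D j * R = P j * corner g j"
    and K: "\<And>d. d \<in> K \<Longrightarrow> d \<le> \<kappa>" and K': "K' = (\<lambda>d. d - c) ` K"
  shows "same_orbit n K (Suc l) g (base D)"
proof -
  define T where "T = (\<lambda>j. mat c s (\<lambda>(y, b). coords g $$ (j * \<kappa> + y, b)))"
  define U where "U = (\<lambda>j. - (T j * mat_inv (corner g j)))"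
  define A where "A = glue U P * mat_inv (frame g)"
  have Tc: "T j \<in> carrier_mat c s" for j by (simp add: T_def)
  have ic: "mat_inv (corner g j) \<in> carrier_mat s s" for j by simp
  have Uc: "U j \<in> carrier_mat c s" for j
    unfolding U_def using mult_carrier_mat[OF Tc ic] by simp
  have Pc: "P j \<in> carrier_mat s s" if "j < l" for j
    using P(1)[OF that] by (simp add: block_upper_def)
  have Rc: "R \<in> carrier_mat s s"
    using R by (simp add: block_upper_def)
  have UC: "U j * corner g j = - T j" if "j < l" for j
  proof -
    have "U j * corner g j = - (T j * mat_inv (corner g j) * corner g j)"
      unfolding U_def by (rule uminus_mult_left_mat)
        (simp add: carrier_matD(2)[OF ic[of j]] carrier_matD(1)[OF corner_carrier])
    also have "T j * mat_inv (corner g j) * corner g j = T j * (mat_inv (corner g j) * corner g j)"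
      by (rule assoc_mult_mat[OF Tc ic corner_carrier])
    finally show ?thesis
      using mat_inv(2)[OF corner_carrier g(3)[OF that]] Tc[of j] by simp
  qed
  have ifc: "mat_inv (frame g) \<in> carrier_mat n n" by simp
  have A: "A \<in> carrier_mat n n"
    unfolding A_def by (rule mult_carrier_mat[OF glue_carrier ifc])
  have Aframe: "A * frame g = glue U P"
    unfolding A_def assoc_mult_mat[OF glue_carrier ifc frame_carrier]
    by (simp add: mat_inv(2)[OF frame_carrier g(2)] right_mult_one_mat[OF glue_carrier])
  have Arest: "A * rest g = glue U P * coords g"
    unfolding A_def coords_def by (rule assoc_mult_mat[OF glue_carrier ifc rest_carrier])
  have detA: "det A \<noteq> 0"
    unfolding A_def det_mult[OF glue_carrier ifc]
    using det_glue[of P U] det_mat_inv[OF frame_carrier g(2)] Pc P(2) by auto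
  have Ag1: "(A * g j) $$ (a, b) = glue U P $$ (a, j * \<kappa> + b)"
    if "j < l" "b < \<kappa>" "a < n" for j a b
  proof -
    have jb: "j * \<kappa> + b < l * \<kappa>" "j * \<kappa> + b < n"
      using block_index_less[OF that(1,2)] n by auto
    have "(A * g j) $$ (a, b) = (\<Sum>x<n. A $$ (a, x) * g j $$ (x, b))"
      by (rule sum_mat_mult_index[OF A g(1)]) (use that le in auto)
    also have "\<dots> = (\<Sum>x<n. A $$ (a, x) * frame g $$ (x, j * \<kappa> + b))"
      using jb that by (intro sum.cong) (auto simp: frame_def)
    also have "\<dots> = (A * frame g) $$ (a, j * \<kappa> + b)"
      by (rule sum_mat_mult_index[OF A frame_carrier, symmetric]) (use that jb in auto)
    finally show ?thesis by (simp add: Aframe)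
  qed
  have Ag2: "(A * g l) $$ (a, b) = of_bool (a = l * \<kappa> + b)" if "b < c" "a < n" for a b
  proof -
    have jb: "\<not> l * \<kappa> + b < l * \<kappa>" "l * \<kappa> + b < n"
      using that n by auto
    have "(A * g l) $$ (a, b) = (\<Sum>x<n. A $$ (a, x) * g l $$ (x, b))"
      by (rule sum_mat_mult_index[OF A g(1)]) (use that n in auto)
    also have "\<dots> = (\<Sum>x<n. A $$ (a, x) * frame g $$ (x, l * \<kappa> + b))"
      using jb that by (intro sum.cong) (auto simp: frame_def)
    also have "\<dots> = (A * frame g) $$ (a, l * \<kappa> + b)"
      by (rule sum_mat_mult_index[OF A frame_carrier, symmetric]) (use that jb in auto)
    finally show ?thesis using that jb by (auto simp: Aframe glue_def)
  qed
  have Ag3: "(A * g l) $$ (a, c + b) =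
      (if a < l * \<kappa> then if a mod \<kappa> < c then 0 else (D (a div \<kappa>) * R) $$ (a mod \<kappa> - c, b)
       else coords g $$ (a, b))"
    if b: "b < s" and a: "a < n" for a b
  proof -
    have "(A * g l) $$ (a, c + b) = (\<Sum>x<n. A $$ (a, x) * g l $$ (x, c + b))"
      by (rule sum_mat_mult_index[OF A g(1)]) (use b a s le in auto)
    also have "\<dots> = (\<Sum>x<n. A $$ (a, x) * rest g $$ (x, b))"
      using b by (intro sum.cong) (auto simp: rest_def)
    also have "\<dots> = (A * rest g) $$ (a, b)"
      by (rule sum_mat_mult_index[OF A rest_carrier, symmetric]) (use a b in auto)
    also have "\<dots> = (\<Sum>x<n. glue U P $$ (a, x) * coords g $$ (x, b))"
      unfolding Arest by (rule sum_mat_mult_index[OF glue_carrier coords_carrier a b])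
    also have "\<dots> =
      (if a < l * \<kappa> then if a mod \<kappa> < c then 0 else (D (a div \<kappa>) * R) $$ (a mod \<kappa> - c, b)
       else coords g $$ (a, b))"
    proof (cases "a < l * \<kappa>")
      case True
      define j where "j = a div \<kappa>"
      have j: "j < l" and r: "a mod \<kappa> < \<kappa>" and aj: "a = j * \<kappa> + a mod \<kappa>"
        using block_index[OF True] by (auto simp: j_def)
      have "(\<Sum>y<s. U j $$ (a mod \<kappa>, y) * coords g $$ (j * \<kappa> + c + y, b)) = - coords g $$ (a, b)"
        if c: "a mod \<kappa> < c"
      proof -
        have "(\<Sum>y<s. U j $$ (a mod \<kappa>, y) * coords g $$ (j * \<kappa> + c + y, b)) =
            (\<Sum>y<s. U j $$ (a mod \<kappa>, y) * corner g j $$ (y, b))"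
          using b by (intro sum.cong) (auto simp: corner_def)
        also have "\<dots> = (U j * corner g j) $$ (a mod \<kappa>, b)"
          by (rule sum_mat_mult_index[OF Uc corner_carrier c b, symmetric])
        also have "\<dots> = - coords g $$ (a, b)"
          unfolding UC[OF j] using c b aj by (simp add: T_def)
        finally show ?thesis .
      qed
      moreover have "(\<Sum>y<s. P j $$ (a mod \<kappa> - c, y) * coords g $$ (j * \<kappa> + c + y, b))
          = (D j * R) $$ (a mod \<kappa> - c, b)" if c: "\<not> a mod \<kappa> < c"
      proof -
        have c': "a mod \<kappa> - c < s" using c r s by simp
        have "(\<Sum>y<s. P j $$ (a mod \<kappa> - c, y) * coords g $$ (j * \<kappa> + c + y, b)) =
            (\<Sum>y<s. P j $$ (a mod \<kappa> - c, y) * corner g j $$ (y, b))"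
          using b by (intro sum.cong) (auto simp: corner_def)
        also have "\<dots> = (P j * corner g j) $$ (a mod \<kappa> - c, b)"
          by (rule sum_mat_mult_index[OF Pc[OF j] corner_carrier c' b, symmetric])
        finally show ?thesis unfolding eq[OF j] .
      qed
      ultimately show ?thesis
        using True by (simp add: glue_sum[OF a] j_def)
    qed (simp add: glue_sum[OF a])
    finally show ?thesis .
  qed
  \<comment> \<open>The first \<kappa> columns of the parabolic factors. For \<open>j < l\<close>
    they come from the j-th diagonal block of \<open>glue\<close>. For \<open>j = l\<close> they
    form the block with rows (1, Z) and (0, \<open>R\<close>), where Z collects the last
    \<open>c\<close> rows of \<open>coords g\<close>, which \<open>A\<close> leaves alone.\<close>
  define w where "w = (\<lambda>j b a.
    if j < l then (if a < \<kappa> then glue U P $$ (j * \<kappa> + a, j * \<kappa> + b) else 0)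
    else if b < c then of_bool (a = b)
    else if a < c then coords g $$ (l * \<kappa> + a, b - c)
    else if a < \<kappa> then R $$ (a - c, b - c) else 0)"
  have baseD: "base D j \<in> carrier_mat n n" "det (base D j) \<noteq> 0" if "j < Suc l" for j
    using det_base[of D j] D that by auto
  show ?thesis
  proof (rule same_orbitI[OF A detA _ baseD, where l = \<kappa> and w = w])
    fix j b a assume j: "j < Suc l" and b: "b < \<kappa>" and a: "a < n"
    show "(A * g j) $$ (a, b) = (\<Sum>x<n. base D j $$ (a, x) * w j b x)"
    proof (cases "j < l")
      case True
      have jb: "j * \<kappa> + b < l * \<kappa>" "j * \<kappa> + b < n" "(j * \<kappa> + b) div \<kappa> = j"
        using block_index_less[OF True b] n b by auto
      have "(\<Sum>x<n. base D j $$ (a, x) * w j b x) = glue U P $$ (a, j * \<kappa> + b)"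
      proof (cases "a < l * \<kappa> \<and> a div \<kappa> = j")
        case aj: True
        then have r: "a mod \<kappa> < \<kappa>" and aj': "a = j * \<kappa> + a mod \<kappa>"
          using block_index by auto
        have "(\<Sum>x<n. base D j $$ (a, x) * w j b x) = base D j $$ (a, a mod \<kappa>) * w j b (a mod \<kappa>)"
        proof (rule sum_eq_term)
          fix x assume x: "x < n" "x \<noteq> a mod \<kappa>"
          show "base D j $$ (a, x) * w j b x = 0"
          proof (cases "x < \<kappa>")
            case True
            then have "a \<noteq> base_row j x" using x aj' \<open>j < l\<close> by (auto simp: base_row_def)
            then show ?thesis using x a \<open>j < l\<close> by (simp add: base_def)
          qed (use \<open>j < l\<close> in \<open>simp add: w_def\<close>)
        qed (use r le in auto)
        also have "\<dots> = glue U P $$ (a, j * \<kappa> + b)"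
          using r aj' a True le by (simp add: base_def base_row_def w_def flip: aj')
        finally show ?thesis .
      next
        case False
        have "(\<Sum>x<n. base D j $$ (a, x) * w j b x) = 0"
        proof (intro sum.neutral ballI)
          fix x assume "x \<in> {..<n}"
          then have x: "x < n" by auto
          show "base D j $$ (a, x) * w j b x = 0"
          proof (cases "x < \<kappa>")
            case xk: True
            then have "a \<noteq> base_row j x"
              using False True block_index_less[OF True xk] by (auto simp: base_row_def)
            then show ?thesis using x a True by (simp add: base_def)
          qed (use True in \<open>simp add: w_def\<close>)
        qed
        moreover have "glue U P $$ (a, j * \<kappa> + b) = 0"
          using False a jb by (auto simp: glue_def)
        ultimately show ?thesis by simp
      qed
      then show ?thesis using Ag1[OF True b a] by simp
    next
      case False
      then have jl: "j = l" using j by simp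
      show ?thesis
      proof (cases "b < c")
        case True
        have "(\<Sum>x<n. base D j $$ (a, x) * w j b x) = base D j $$ (a, b) * w j b b"
          by (rule sum_eq_term) (use True b le in \<open>auto simp: w_def jl\<close>)
        also have "\<dots> = of_bool (a = l * \<kappa> + b)"
          using a b le True by (simp add: base_def base_row_def w_def jl)
        finally show ?thesis using Ag2[OF True a] jl by simp
      next
        case bc: False
        then have bs: "b - c < s" "c + (b - c) = b" using b s by auto
        have cn: "c < \<kappa>" "c \<le> n" using bc b n by auto
        define G where "G = (\<lambda>x. base D j $$ (a, x) * w j b x)"
        have "(\<Sum>x<n. G x) = (\<Sum>x<min \<kappa> n. G x) + (\<Sum>x<n - \<kappa>. G (\<kappa> + x))"
          by (rule sum_lessThan_split)
        also have "(\<Sum>x<n - \<kappa>. G (\<kappa> + x)) = 0"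
          using bc cn by (intro sum.neutral) (auto simp: G_def w_def jl)
        also have "min \<kappa> n = \<kappa>" using le by simp
        also have "(\<Sum>x<\<kappa>. G x) = (\<Sum>x<min c \<kappa>. G x) + (\<Sum>x<s. G (c + x))"
          unfolding s by (rule sum_lessThan_split)
        also have "min c \<kappa> = c" using cn by simp
        finally have split: "(\<Sum>x<n. G x) = (\<Sum>x<c. G x) + (\<Sum>x<s. G (c + x))" by simp
        have G1: "G x = of_bool (a = l * \<kappa> + x) * coords g $$ (l * \<kappa> + x, b - c)" if "x < c" for x
          using that a cn le bc by (simp add: G_def base_def base_row_def w_def jl)
        have G2: "G (c + x) =
            (if a < l * \<kappa> \<and> c \<le> a mod \<kappa> then D (a div \<kappa>) $$ (a mod \<kappa> - c, x) else 0)
              * R $$ (x, b - c)" if "x < s" for x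
          using that a cn le bc s by (simp add: G_def base_def w_def jl)
        show ?thesis
        proof (cases "a < l * \<kappa>")
          case True
          have "(\<Sum>x<c. G x) = 0"
            using G1 True by (intro sum.neutral) auto
          moreover have "(\<Sum>x<s. G (c + x)) =
              (if a mod \<kappa> < c then 0 else (D (a div \<kappa>) * R) $$ (a mod \<kappa> - c, b - c))"
          proof (cases "a mod \<kappa> < c")
            case True
            then show ?thesis using G2 by simp
          next
            case False
            have "a mod \<kappa> - c < s" using False block_index[OF True] s by simp
            then show ?thesis
              using sum_mat_mult_index[OF D(1) Rc, of "a div \<kappa>" "a mod \<kappa> - c" "b - c"]
                block_index[OF True] bs True False G2 by simp
          qed
          ultimately show ?thesis
            using Ag3[OF bs(1) a] True split bs(2) jl unfolding G_def[symmetric] by simp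
        next
          case False
          have ac: "a - l * \<kappa> < c" "a = l * \<kappa> + (a - l * \<kappa>)" using False a n by linarith+
          have "(\<Sum>x<c. G x) = G (a - l * \<kappa>)"
            by (rule sum_eq_term) (use G1 ac in auto)
          also have "\<dots> = coords g $$ (a, b - c)"
            using G1[OF ac(1)] False by simp
          finally have "(\<Sum>x<c. G x) = coords g $$ (a, b - c)" .
          moreover have "(\<Sum>x<s. G (c + x)) = 0"
            using G2 False by (intro sum.neutral) auto
          ultimately show ?thesis
            using Ag3[OF bs(1) a] False split bs(2) jl unfolding G_def[symmetric] by simp
        qed
      qed
    qed
  next
    fix j d b a assume j: "j < Suc l" and d: "d \<in> K" "b < d" "d \<le> a" and a: "a < n"
    have dk: "d \<le> \<kappa>" using K d by auto
    \<comment> \<open>An entry with \<open>c \<le> b < d \<le> a\<close> becomes the entry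
      \<open>(a - c, b - c)\<close> across the step \<open>d - c\<close>. All other entries below a
      step of \<open>K\<close> lie in the identity or zero parts of the blocks.\<close>
    have dc: "d - c \<in> K'" using d K' by auto
    show "w j b a = 0"
    proof (cases "j < l \<and> a < \<kappa>")
      case True
      then have *: "j * \<kappa> + a < l * \<kappa>" "j * \<kappa> + b < l * \<kappa>" "j * \<kappa> + a < n" "j * \<kappa> + b < n"
        "(j * \<kappa> + a) div \<kappa> = j" "(j * \<kappa> + b) div \<kappa> = j" "(j * \<kappa> + a) mod \<kappa> = a" "(j * \<kappa> + b) mod \<kappa> = b"
        using block_index_less[of j a] block_index_less[of j b] n d by auto
      have "P j $$ (a - c, b - c) = 0" if "\<not> a < c" "\<not> b < c"
        using P(1)[of j] dc True that d s unfolding block_upper_def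
        by (auto dest!: bspec[of _ _ "d - c"])
      then show ?thesis
        using True * d by (auto simp: w_def glue_def)
    next
      case False
      have "R $$ (a - c, b - c) = 0" if "\<not> a < c" "\<not> b < c" "a < \<kappa>"
        using R dc that d s unfolding block_upper_def
        by (auto dest!: bspec[of _ _ "d - c"])
      then show ?thesis
        using False d dk by (auto simp: w_def)
    qed
  qed (use g K le in auto)
qed

end

section \<open>Rational curves through the normal form and the induction\<close>

context flag_reduction begin

lemma regular_mat_curve_frame:
  assumes "\<And>j. j \<le> l \<Longrightarrow> regular_mat_curve n n (\<lambda>t. \<gamma> t j)"
  shows "regular_mat_curve n n (\<lambda>t. frame (\<gamma> t))"
  unfolding frame_def
proof (rule regular_mat_curve_mat)
  fix a x assume ax: "a < n" "x < n"
  have "regular_rational (\<lambda>t. \<gamma> t (x div \<kappa>) $$ (a, x mod \<kappa>))" if "x < l * \<kappa>"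
    using block_index[OF that] ax le by (intro regular_mat_curve_index[OF assms]) auto
  moreover have "regular_rational (\<lambda>t. \<gamma> t l $$ (a, x - l * \<kappa>))"
    using ax by (intro regular_mat_curve_index[OF assms]) auto
  ultimately show "regular_rational (\<lambda>t. case (a, x) of (a, x) \<Rightarrow>
      if x < l * \<kappa> then \<gamma> t (x div \<kappa>) $$ (a, x mod \<kappa>) else \<gamma> t l $$ (a, x - l * \<kappa>))"
    by (cases "x < l * \<kappa>") auto
qed

lemma regular_mat_curve_corner:
  assumes \<gamma>: "\<And>j. j \<le> l \<Longrightarrow> regular_mat_curve n n (\<lambda>t. \<gamma> t j)"
    and "det (frame (\<gamma> 0)) \<noteq> 0" and j: "j < l"
  shows "regular_mat_curve s s (\<lambda>t. corner (\<gamma> t) j)"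
proof -
  have "regular_mat_curve n s (\<lambda>t. rest (\<gamma> t))"
    unfolding rest_def
  proof (rule regular_mat_curve_mat, clarsimp)
    fix a b assume "a < n" "b < s"
    then show "regular_rational (\<lambda>t. \<gamma> t l $$ (a, c + b))"
      using s le by (intro regular_mat_curve_index[OF \<gamma>]) auto
  qed
  then have coords: "regular_mat_curve n s (\<lambda>t. coords (\<gamma> t))"
    unfolding coords_def
    by (intro regular_mat_curve_mult[of n n] regular_mat_curve_inv regular_mat_curve_frame assms)
  show ?thesis
    unfolding corner_def
  proof (rule regular_mat_curve_mat, clarsimp)
    fix y b assume yb: "y < s" "b < s"
    then show "regular_rational (\<lambda>t. coords (\<gamma> t) $$ (j * \<kappa> + c + y, b))"
      using corner_index_less[OF j yb(1)] n by (intro regular_mat_curve_index[OF coords]) linarith+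
  qed
qed

end

text \<open>After the reduction the top subspace has become the whole space of dimension
  \<open>s\<close>, which imposes no condition. Dropping it shortens the flags by one.\<close>

lemma block_upper_insert: "block_upper s (insert s K) p \<longleftrightarrow> block_upper s K p"
  by (auto simp: block_upper_def)

text \<open>Stands in for the statement that the orbit of \<open>h\<close> contains a neighbourhood
  of \<open>h\<close>. The equation for \<open>\<gamma> 0\<close> is between functions, so a curve
  has to agree with \<open>h\<close> also at indices from \<open>m\<close> on.\<close>

definition generic_tuple :: "nat \<Rightarrow> nat set \<Rightarrow> nat \<Rightarrow> (nat \<Rightarrow> 'k::field mat) \<Rightarrow> bool" where
  "generic_tuple n K m h \<longleftrightarrow>
     (\<forall>j<m. h j \<in> carrier_mat n n \<and> det (h j) \<noteq> 0) \<and>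
     (\<forall>\<gamma>. (\<forall>j<m. regular_mat_curve n n (\<lambda>t. \<gamma> t j)) \<longrightarrow> \<gamma> 0 = h \<longrightarrow>
        (\<forall>\<^sub>F t in cofinite. same_orbit n K m (\<gamma> t) h))"

text \<open>Write C_j for the corners along the curve. If A (h'_l C_j^-1) = h'_j p_j and A h'_l =
  h'_l p_l, then h'_l p_l = h'_j p_j C_j, that is D_j p_l = p_j C_j. This is the relation that
  \<open>same_orbit_base\<close> asks for, with R = p_l.\<close>

lemma (in flag_reduction) generic_tuple_base:
  fixes h' :: "nat \<Rightarrow> 'k::field mat"
  assumes h': "generic_tuple s K'' (Suc l) h'"
    and K: "\<And>d. d \<in> K \<Longrightarrow> d \<le> \<kappa>" and K': "(\<lambda>d. d - c) ` K = insert s K''"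
  shows "generic_tuple n K (Suc l) (base (\<lambda>j. mat_inv (h' j) * h' l))"
proof -
  define D where "D = (\<lambda>j. mat_inv (h' j) * h' l)"
  have hc: "h' j \<in> carrier_mat s s" and hd: "det (h' j) \<noteq> 0" if "j \<le> l" for j
    using h' that by (auto simp: generic_tuple_def)
  have hi: "mat_inv (h' j) \<in> carrier_mat s s" if "j \<le> l" for j
    using mat_inv_carrier[OF hc[OF that]] .
  have Dc: "D j \<in> carrier_mat s s" if "j \<le> l" for j
    unfolding D_def by (rule mult_carrier_mat[OF hi[OF that] hc]) simp
  have Dd: "det (D j) \<noteq> 0" if "j \<le> l" for j
    unfolding D_def det_mult[OF hi[OF that] hc[OF order_refl]]
    using det_mat_inv[OF hc hd] hd that by auto
  have "\<forall>\<^sub>F t in cofinite. same_orbit n K (Suc l) (\<gamma> t) (base D)"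
    if reg: "\<And>j. j < Suc l \<Longrightarrow> regular_mat_curve n n (\<lambda>t. \<gamma> t j)" and \<gamma>0: "\<gamma> 0 = base D" for \<gamma>
  proof -
    have reg: "\<And>j. j \<le> l \<Longrightarrow> regular_mat_curve n n (\<lambda>t. \<gamma> t j)"
      using reg by auto
    have f0: "det (frame (\<gamma> 0)) \<noteq> 0"
      by (simp add: \<gamma>0 frame_base)
    have c0: "corner (\<gamma> 0) j = D j" if "j < l" for j
      unfolding \<gamma>0 by (rule corner_base) (use that Dc in auto)
    \<comment> \<open>Inverting the corners turns the two-sided action on them into the action on
      tuples of flags. At \<open>0\<close> the entry is \<open>h' l * mat_inv (D j)\<close>, which
      equals \<open>h' j\<close>; keeping \<open>h'\<close> from index \<open>l\<close> on makes the
      curve start exactly at \<open>h'\<close>.\<close>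
    define \<gamma>' where "\<gamma>' = (\<lambda>t j. if j < l then h' l * mat_inv (corner (\<gamma> t) j) else h' j)"
    have reg': "regular_mat_curve s s (\<lambda>t. corner (\<gamma> t) j)" if "j < l" for j
      using regular_mat_curve_corner[OF reg f0 that] by simp
    have "regular_mat_curve s s (\<lambda>t. \<gamma>' t j)" if "j < Suc l" for j
    proof (cases "j < l")
      case True
      then show ?thesis
        using c0[OF True] Dd hc
        by (auto simp: \<gamma>'_def intro!: regular_mat_curve_mult[of s s _ s] regular_mat_curve_const
            regular_mat_curve_inv reg')
    qed (use that hc in \<open>simp add: \<gamma>'_def regular_mat_curve_const\<close>)
    moreover have "\<gamma>' 0 = h'"
    proof
      fix j show "\<gamma>' 0 j = h' j"
      proof (cases "j < l")
        case True
        note car = hc[of l, simplified] hi[of l, simplified] hc[OF less_imp_le[OF True]] hi[OF less_imp_le[OF True]]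
        have "D j * (mat_inv (h' l) * h' j) = mat_inv (h' j) * (h' l * (mat_inv (h' l) * h' j))"
          unfolding D_def by (rule assoc_mult_mat[OF car(4,1) mult_carrier_mat[OF car(2,3)]])
        also have "h' l * (mat_inv (h' l) * h' j) = h' j"
          using assoc_mult_mat[OF car(1,2,3)] mat_inv(1)[OF hc[of l] hd[of l]] car by simp
        finally have "mat_inv (D j) = mat_inv (h' l) * h' j"
          using mat_inv(2)[OF hc[of j] hd[of j]] True car
          by (intro mat_inv_unique[OF Dc mult_carrier_mat[OF car(2,3)]]) auto
        then have "\<gamma>' 0 j = h' l * (mat_inv (h' l) * h' j)"
          using True by (simp add: \<gamma>'_def c0)
        also have "\<dots> = h' j"
          using assoc_mult_mat[OF car(1,2,3)] mat_inv(1)[OF hc[of l] hd[of l]] car by simp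
        finally show ?thesis .
      qed (simp add: \<gamma>'_def)
    qed
    ultimately have "\<forall>\<^sub>F t in cofinite. same_orbit s K'' (Suc l) (\<gamma>' t) h'"
      using h' by (auto simp: generic_tuple_def)
    moreover have "\<forall>\<^sub>F t in cofinite. det (frame (\<gamma> t)) \<noteq> 0"
      by (rule regular_mat_curve_eventually_invertible[where \<gamma> = "\<lambda>t. frame (\<gamma> t)",
            OF regular_mat_curve_frame[OF reg] f0])
    moreover have "\<forall>\<^sub>F t in cofinite. \<forall>j\<in>{..<l}. det (corner (\<gamma> t) j) \<noteq> 0"
      by (intro eventually_ball_finite ballI regular_mat_curve_eventually_invertible[OF reg'])
        (use c0 Dd in auto)
    ultimately show ?thesis
    proof eventually_elim
      case (elim t)
      then obtain A p where A: "A \<in> carrier_mat s s" "det A \<noteq> 0"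
        and p: "\<And>j. j < Suc l \<Longrightarrow> block_upper s K'' (p j)"
          "\<And>j. j < Suc l \<Longrightarrow> A * \<gamma>' t j = h' j * p j"
        by (auto simp: same_orbit_def)
      have pc: "p j \<in> carrier_mat s s" if "j \<le> l" for j
        using p(1)[of j] that by (simp add: block_upper_def)
      note Bc = hc[OF order_refl]
      have AB: "A * h' l = h' l * p l"
        using p(2)[of l] by (simp add: \<gamma>'_def)
      show ?case
      proof (rule same_orbit_base[where P = p and R = "p l"])
        show "block_upper s (insert s K'') (p j)" if "j < l" for j
          using p(1) that by (auto simp: block_upper_insert)
        show "block_upper s (insert s K'') (p l)"
          using p(1) by (auto simp: block_upper_insert)
        fix j assume j: "j < l"
        then have jl: "j \<le> l" by simp
        let ?C = "corner (\<gamma> t) j"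
        have Cd: "det ?C \<noteq> 0" using elim j by auto
        note Ci = mat_inv_carrier[OF corner_carrier[of "\<gamma> t" j]]
        have Ap: "A * (h' l * mat_inv ?C) = h' j * p j"
          using p(2)[of j] j by (simp add: \<gamma>'_def)
        have "det A * (det (h' l) * det (mat_inv ?C)) = det (h' j) * det (p j)"
          using arg_cong[OF Ap, of det] det_mult[OF A(1) mult_carrier_mat[OF Bc Ci]]
            det_mult[OF Bc Ci] det_mult[OF hc[OF jl] pc[OF jl]] by simp
        then show "det (p j) \<noteq> 0"
          using A(2) hd[of l] det_mat_inv[OF corner_carrier Cd] by auto
        have "A * (h' l * mat_inv ?C) * ?C = A * h' l * (mat_inv ?C * ?C)"
          using assoc_mult_mat[OF A(1) Bc Ci] assoc_mult_mat[OF mult_carrier_mat[OF A(1) Bc] Ci corner_carrier]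
          by simp
        also have "\<dots> = h' l * p l"
          using mat_inv(2)[OF corner_carrier Cd] AB right_mult_one_mat[OF mult_carrier_mat[OF A(1) Bc]]
          by simp
        finally have hp: "h' l * p l = h' j * (p j * ?C)"
          using assoc_mult_mat[OF hc[OF jl] pc[OF jl] corner_carrier] Ap by simp
        have "D j * p l = mat_inv (h' j) * (h' l * p l)"
          unfolding D_def by (rule assoc_mult_mat[OF hi[OF jl] Bc pc]) simp
        also have "\<dots> = mat_inv (h' j) * h' j * (p j * ?C)"
          unfolding hp
          by (rule assoc_mult_mat[OF hi[OF jl] hc[OF jl] mult_carrier_mat[OF pc[OF jl] corner_carrier], symmetric])
        also have "\<dots> = p j * ?C"
          using mat_inv(2)[OF hc[OF jl] hd[OF jl]]
          by (simp add: left_mult_one_mat[OF mult_carrier_mat[OF pc[OF jl] corner_carrier]])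
        finally show "D j * p l = p j * ?C" .
      qed (use elim regular_mat_curve_carrier[OF reg] Dc Dd K K' in auto)
    qed
  qed
  moreover have "base D j \<in> carrier_mat n n \<and> det (base D j) \<noteq> 0" if "j < Suc l" for j
    using det_base[of D j] Dc Dd that by auto
  ultimately show ?thesis
    unfolding generic_tuple_def D_def by blast
qed

text \<open>Monotonicity is listed beside the growth condition because the latter says nothing when
  \<open>l = 0\<close>. Only weak inequalities are assumed, since these survive truncated
  subtraction.\<close>

lemma generic_tuple_exists:
  fixes k :: "nat \<Rightarrow> nat"
  assumes "\<And>i. 1 \<le> i \<Longrightarrow> i < r \<Longrightarrow> k i \<le> k (Suc i) \<and> l * k i \<le> k (Suc i)"
    and "0 < r \<Longrightarrow> k r \<le> n \<and> l * k r \<le> n"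
  shows "\<exists>h :: nat \<Rightarrow> 'k::field mat. generic_tuple n (k ` {1..r}) (Suc l) h"
  using assms
proof (induction r arbitrary: n k)
  case 0
  \<comment> \<open>Without subspaces every matrix is block upper, so \<open>A = 1\<close> and the
    curve itself as the factors \<open>p\<close> solve the equation.\<close>
  have "same_orbit n {} (Suc l) (\<gamma> t) (\<lambda>j. 1\<^sub>m n)"
    if "\<forall>j<Suc l. regular_mat_curve n n (\<lambda>t. \<gamma> t j)" for \<gamma> :: "'k \<Rightarrow> nat \<Rightarrow> 'k mat" and t
    unfolding same_orbit_def
  proof (intro exI conjI allI impI)
    fix j assume "j < Suc l"
    then have "\<gamma> t j \<in> carrier_mat n n"
      using that regular_mat_curve_carrier by blast
    then show "block_upper n {} (\<gamma> t j)" "1\<^sub>m n * \<gamma> t j = 1\<^sub>m n * \<gamma> t j"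
      by (auto simp: block_upper_def)
  qed auto
  then show ?case
    by (auto simp: generic_tuple_def intro!: exI[of _ "\<lambda>j. 1\<^sub>m n"])
next
  case (Suc r)
  define \<kappa> c s where "\<kappa> = k (Suc r)" and "c = n - l * \<kappa>" and "s = \<kappa> - c"
  have bounds: "\<kappa> \<le> n" "l * \<kappa> \<le> n"
    using Suc.prems(2) by (auto simp: \<kappa>_def)
  interpret flag_reduction n l \<kappa> c s
    by unfold_locales (use bounds in \<open>auto simp: c_def s_def\<close>)
  \<comment> \<open>Multiplying by \<open>l\<close> removes \<open>l * c\<close> on the left, which
    is at least \<open>c\<close> unless \<open>l = 0\<close>, and then the left side is 0.\<close>
  have trunc: "l * (a - c) \<le> b - c" if "l * a \<le> b" for a b
  proof (cases l)
    case (Suc l')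
    then have "l * (a - c) \<le> l * a - c"
      by (simp add: diff_mult_distrib2 diff_le_mono2)
    then show ?thesis using that by linarith
  qed simp
  \<comment> \<open>The former top dimension \<kappa>, reduced to \<open>s\<close>, takes over the
    part of \<open>n\<close>: the old inequalities between \<open>k r\<close> and
    \<open>k (Suc r)\<close> become the bounds by the ambient dimension.\<close>
  have "\<exists>h :: nat \<Rightarrow> 'k mat. generic_tuple s ((\<lambda>i. k i - c) ` {1..r}) (Suc l) h"
  proof (rule Suc.IH)
    show "k i - c \<le> k (Suc i) - c \<and> l * (k i - c) \<le> k (Suc i) - c" if "1 \<le> i" "i < r" for i
      using Suc.prems(1)[of i] that by (auto intro: trunc diff_le_mono)
    show "k r - c \<le> s \<and> l * (k r - c) \<le> s" if "0 < r"
      using Suc.prems(1)[of r] that by (auto simp: s_def \<kappa>_def intro: trunc diff_le_mono)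
  qed
  then obtain h' :: "nat \<Rightarrow> 'k mat" where h': "generic_tuple s ((\<lambda>i. k i - c) ` {1..r}) (Suc l) h'" ..
  have mono: "k i \<le> \<kappa>" if "1 \<le> i" "i \<le> Suc r" for i
    using that(2,1)
  proof (induction i rule: inc_induct)
    case base then show ?case by (simp add: \<kappa>_def)
  next
    case (step i)
    then show ?case using Suc.prems(1)[of i] by auto
  qed
  show ?case
  proof (rule exI, rule generic_tuple_base[OF h'])
    show "(\<lambda>d. d - c) ` k ` {1..Suc r} = insert s ((\<lambda>i. k i - c) ` {1..r})"
      by (auto simp: image_image s_def \<kappa>_def atLeastAtMostSuc_conv)
  qed (use mono in auto)
qed

section \<open>Flags as column spans\<close>

definition std_subspace :: "nat \<Rightarrow> nat \<Rightarrow> 'k::field vec set" where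
  "std_subspace n d = {v \<in> carrier_vec n. \<forall>a<n. d \<le> a \<longrightarrow> v $ a = 0}"

definition col_subspace :: "nat \<Rightarrow> nat \<Rightarrow> 'k::field mat \<Rightarrow> 'k vec set" where
  "col_subspace n d g = (\<lambda>v. g *\<^sub>v v) ` std_subspace n d"

context vec_space
begin

text \<open>Independence and span computed inside \<open>W\<close> agree with those of the ambient
  space, so bases of flag members can all be compared there.\<close>

lemma subspace_basis_iff:
  assumes "VectorSpace.subspace class_ring W V"
  shows "vectorspace.basis class_ring (V\<lparr>carrier := W\<rparr>) B \<longleftrightarrow> B \<subseteq> W \<and> lin_indpt B \<and> span B = W"
proof -
  interpret W: vectorspace class_ring "V\<lparr>carrier := W\<rparr>"
    using assms subspace_is_vs by simp
  have sub: "submodule class_ring W V"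
    using assms by (simp add: subspace_def)
  show ?thesis
    using span_li_not_depend[OF _ sub, of B] by (auto simp: W.basis_def)
qed

lemma subspace_carrier: "VectorSpace.subspace class_ring W V \<Longrightarrow> W \<subseteq> carrier_vec n"
  by (auto simp: subspace_def submodule_def module_vec_simps)

text \<open>Independent sets have at most as many elements as the dimension, so a maximal one
  containing \<open>A\<close> inside \<open>W\<close> exists, and by maximality it spans
  \<open>W\<close>.\<close>

lemma lin_indpt_extends_to_basis:
  assumes W: "VectorSpace.subspace class_ring W V" and A: "A \<subseteq> W" "lin_indpt A"
  obtains B where "A \<subseteq> B" "finite B" "lin_indpt B" "span B = W" "B \<subseteq> W"
    "card B = vectorspace.dim class_ring (V\<lparr>carrier := W\<rparr>)"
proof -
  interpret W: vectorspace class_ring "V\<lparr>carrier := W\<rparr>"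
    using W subspace_is_vs by simp
  have sub: "submodule class_ring W V"
    using W by (simp add: subspace_def)
  have Wc: "W \<subseteq> carrier_vec n" by (rule subspace_carrier[OF W])
  define P where "P = (\<lambda>S. A \<subseteq> S \<and> S \<subseteq> W \<and> lin_indpt S)"
  have "finite S \<and> card S \<le> dim" if "P S" for S
    using that Wc li_le_dim[OF fin_dim, of S] by (auto simp: P_def)
  moreover have "P A" using A by (simp add: P_def)
  ultimately obtain B where B: "finite B" "maximal B P"
    using maximal_exists[of P dim A] by blast
  then have BP: "A \<subseteq> B" "B \<subseteq> W" "lin_indpt B" and max: "\<And>S. P S \<Longrightarrow> B \<subseteq> S \<Longrightarrow> S = B"
    by (auto simp: maximal_def P_def)
  have "span B = W"
  proof
    show "span B \<subseteq> W" by (rule span_is_subset[OF BP(2) sub])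
    show "W \<subseteq> span B"
    proof
      fix v assume v: "v \<in> W"
      show "v \<in> span B"
      proof (rule ccontr)
        assume nv: "v \<notin> span B"
        have "B \<subseteq> carrier_vec n" using BP(2) Wc by auto
        then have vB: "v \<notin> B" using nv in_own_span by blast
        have "lin_indpt (B \<union> {v})"
          using lin_dep_iff_in_span[of B v] \<open>B \<subseteq> carrier_vec n\<close> BP(3) v Wc vB nv by auto
        then have "B \<union> {v} = B"
          using BP v by (intro max) (auto simp: P_def)
        with vB show False by auto
      qed
    qed
  qed
  moreover have "vectorspace.basis class_ring (V\<lparr>carrier := W\<rparr>) B"
    using subspace_basis_iff[OF W] BP \<open>span B = W\<close> by auto
  ultimately show thesis
    using that[of B] BP B(1) W.dim_basis[OF B(1)] by auto
qed

lemma span_list_eq: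
  assumes "set bs \<subseteq> carrier_vec n"
  shows "span (set bs) = (\<lambda>v. mat_of_cols n bs *\<^sub>v v) ` carrier_vec (length bs)"
proof -
  have dim: "\<forall>w\<in>set bs. dim_vec w = n" using assms by auto
  have "span_list bs = (\<lambda>v. mat_of_cols n bs *\<^sub>v v) ` carrier_vec (length bs)"
    unfolding span_list_def lincomb_list_as_mat_mult[OF dim]
  proof (safe; clarsimp?)
    fix v :: "'a vec" assume v: "v \<in> carrier_vec (length bs)"
    then have "v = vec (length bs) (\<lambda>i. v $ i)" by auto
    then show "\<exists>c. mat_of_cols n bs *\<^sub>v v = mat_of_cols n bs *\<^sub>v vec (length bs) c" by metis
  qed
  then show ?thesis using span_list_as_span[OF assms] by simp
qed

lemma span_take_cols:
  fixes g :: "'a mat"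
  assumes g: "g \<in> carrier_mat n n" and d: "d \<le> n"
  shows "span (set (take d (cols g))) = col_subspace n d g"
proof -
  have len: "length (take d (cols g)) = d" using g d by auto
  have mv: "mat_of_cols n (take d (cols g)) *\<^sub>v v = g *\<^sub>v vec n (\<lambda>a. if a < d then v $ a else 0)"
    if v: "v \<in> carrier_vec d" for v
  proof (rule eq_vecI)
    fix i assume "i < dim_vec (g *\<^sub>v vec n (\<lambda>a. if a < d then v $ a else 0))"
    then have i: "i < n" using g by auto
    have "(mat_of_cols n (take d (cols g)) *\<^sub>v v) $ i = (\<Sum>a\<in>{0..<d}. g $$ (i, a) * v $ a)"
      using i v g d len by (auto simp: scalar_prod_def mat_of_cols_index intro!: sum.cong)
    also have "\<dots> = (\<Sum>a\<in>{0..<n}. g $$ (i, a) * (if a < d then v $ a else 0))"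
      using d by (intro sum.mono_neutral_cong_left) auto
    also have "\<dots> = (g *\<^sub>v vec n (\<lambda>a. if a < d then v $ a else 0)) $ i"
      using i g by (auto simp: scalar_prod_def)
    finally show "(mat_of_cols n (take d (cols g)) *\<^sub>v v) $ i = (g *\<^sub>v vec n (\<lambda>a. if a < d then v $ a else 0)) $ i" .
  qed (use g in auto)
  have "set (take d (cols g)) \<subseteq> carrier_vec n"
    using cols_dim[of g] g set_take_subset[of d "cols g"] by auto
  then have "span (set (take d (cols g))) =
      (\<lambda>v. mat_of_cols n (take d (cols g)) *\<^sub>v v) ` carrier_vec d"
    using span_list_eq[of "take d (cols g)"] len by simp
  also have "\<dots> = (\<lambda>v. g *\<^sub>v v) ` (\<lambda>v. vec n (\<lambda>a. if a < d then v $ a else 0)) ` carrier_vec d"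
    unfolding image_image using mv by (intro image_cong) auto
  also have "(\<lambda>v. vec n (\<lambda>a. if a < d then v $ a else 0)) ` carrier_vec d = (std_subspace n d :: 'a vec set)"
  proof (intro equalityI subsetI)
    fix w :: "'a vec" assume w: "w \<in> std_subspace n d"
    then have "w = vec n (\<lambda>a. if a < d then vec d (\<lambda>a. w $ a) $ a else 0)"
      by (intro eq_vecI) (auto simp: std_subspace_def)
    then show "w \<in> (\<lambda>v. vec n (\<lambda>a. if a < d then v $ a else 0)) ` carrier_vec d"
      by (rule image_eqI) auto
  qed (auto simp: std_subspace_def)
  finally show ?thesis by (simp add: col_subspace_def)
qed

lemma lin_indpt_subset: "lin_indpt B \<Longrightarrow> A \<subseteq> B \<Longrightarrow> lin_indpt A"
  using subset_li_is_li by blast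

lemma invertible_cols:
  fixes g :: "'a mat"
  assumes g: "g \<in> carrier_mat n n" "det g \<noteq> 0"
  shows "distinct (cols g)" "lin_indpt (set (cols g))"
proof -
  show "lin_indpt (set (cols g))"
    using lin_dep_cols_imp_det_0[OF g(1)] g(2) by blast
  show "distinct (cols g)"
    unfolding distinct_conv_nth
    using det_identical_columns[OF g(1)] g by auto
qed

lemma col_subspace_basis:
  fixes g :: "'a mat"
  assumes g: "g \<in> carrier_mat n n" "det g \<noteq> 0" and d: "d \<le> n"
  shows "subspace_of_dim n d (col_subspace n d g)"
    and "is_basis_of n (col_subspace n d g) (take d (cols g))"
proof -
  let ?W = "col_subspace n d g"
  let ?B = "set (take d (cols g))"
  have li: "lin_indpt ?B"
    using invertible_cols(2)[OF g] set_take_subset by (rule lin_indpt_subset)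
  have car: "?B \<subseteq> carrier_vec n"
    using cols_dim[of g] g set_take_subset[of d "cols g"] by auto
  have sub: "VectorSpace.subspace class_ring ?W V"
    using span_is_subspace[of ?B] car by (simp add: span_take_cols[OF g(1) d])
  interpret W: vectorspace class_ring "V\<lparr>carrier := ?W\<rparr>"
    using sub subspace_is_vs by simp
  have dist: "distinct (take d (cols g))"
    using invertible_cols(1)[OF g] by (rule distinct_take)
  have basis: "vectorspace.basis class_ring (V\<lparr>carrier := ?W\<rparr>) ?B"
    using subspace_basis_iff[OF sub] li car in_own_span[of ?B] by (auto simp: span_take_cols[OF g(1) d])
  show "is_basis_of n ?W (take d (cols g))"
    using dist basis by (simp add: is_basis_of_def)
  have "card ?B = d"
    using distinct_card[OF dist] g d by simp
  then show "subspace_of_dim n d ?W"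
    using sub W.dim_basis[OF _ basis] by simp
qed

lemma invertible_of_basis:
  fixes bs :: "'a vec list"
  assumes bs: "distinct bs" "lin_indpt (set bs)" "set bs \<subseteq> carrier_vec n" "length bs = n"
  shows "mat_of_cols n bs \<in> carrier_mat n n" "det (mat_of_cols n bs) \<noteq> 0" "cols (mat_of_cols n bs) = bs"
proof -
  show car: "mat_of_cols n bs \<in> carrier_mat n n" using bs by auto
  show cols: "cols (mat_of_cols n bs) = bs" using bs by (intro cols_mat_of_cols) auto
  show "det (mat_of_cols n bs) \<noteq> 0"
  proof
    assume "det (mat_of_cols n bs) = 0"
    then obtain v where v: "v \<in> carrier_vec n" "v \<noteq> 0\<^sub>v n" "mat_of_cols n bs *\<^sub>v v = 0\<^sub>v n"
      using det_0_iff_vec_prod_zero[OF car] by blast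
    have dim: "\<forall>w\<in>set bs. dim_vec w = n" using bs by auto
    \<comment> \<open>Linear combinations over a set take coefficients indexed by vectors. Since
      \<open>bs\<close> is distinct, each vector determines its position and hence its entry of
      \<open>v\<close>.\<close>
    define c where "c = (\<lambda>w. v $ (THE i. i < n \<and> bs ! i = w))"
    have c: "c (bs ! i) = v $ i" if "i < n" for i
    proof -
      have "(THE j. j < n \<and> bs ! j = bs ! i) = i"
        using bs(1,4) that nth_eq_iff_index_eq by (intro the_equality) auto
      then show ?thesis by (simp add: c_def)
    qed
    have "lincomb c (set bs) = lincomb_list (\<lambda>i. c (bs ! i)) bs"
      using lincomb_as_lincomb_list_distinct[OF bs(3,1)] by simp
    also have "\<dots> = mat_of_cols n bs *\<^sub>v vec (length bs) (\<lambda>i. c (bs ! i))"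
      by (rule lincomb_list_as_mat_mult[OF dim])
    also have "vec (length bs) (\<lambda>i. c (bs ! i)) = v"
      using v c bs(4) by (intro eq_vecI) auto
    finally have "lincomb c (set bs) = 0\<^sub>v n" using v by simp
    then have "c w = 0" if "w \<in> set bs" for w
      using not_lindepD[OF bs(2), of "set bs" c] that by auto
    then have "v $ i = 0" if "i < n" for i
      using c[OF that] that bs(4) nth_mem by metis
    with v show False by (metis eq_vecI carrier_vecD index_zero_vec)
  qed
qed

lemma lin_indpt_list_extends:
  fixes W :: "'a vec set"
  assumes W: "VectorSpace.subspace class_ring W V"
    and bs: "distinct bs" "lin_indpt (set bs)" "set bs \<subseteq> W"
  obtains cs where "distinct (bs @ cs)" "lin_indpt (set (bs @ cs))" "set (bs @ cs) \<subseteq> W"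
    "span (set (bs @ cs)) = W"
    "length (bs @ cs) = vectorspace.dim class_ring (V\<lparr>carrier := W\<rparr>)"
proof -
  obtain B where B: "set bs \<subseteq> B" "finite B" "lin_indpt B" "span B = W" "B \<subseteq> W"
    "card B = vectorspace.dim class_ring (V\<lparr>carrier := W\<rparr>)"
    using lin_indpt_extends_to_basis[OF W bs(3,2)] .
  obtain cs where cs: "set cs = B - set bs" "distinct cs"
    using finite_distinct_list[of "B - set bs"] B(2) by auto
  have set: "set (bs @ cs) = B" and dist: "distinct (bs @ cs)"
    using cs bs(1) B(1) by auto
  show thesis
    by (rule that[of cs]) (use dist B distinct_card[OF dist] in \<open>auto simp only: set\<close>)
qed

lemma subspace_carrier_vec:
  "VectorSpace.subspace class_ring (carrier_vec n) V"
  "vectorspace.dim class_ring (V\<lparr>carrier := carrier_vec n\<rparr>) = n"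
proof -
  have "V\<lparr>carrier := carrier_vec n\<rparr> = V" by (simp add: module_vec_def)
  then show "vectorspace.dim class_ring (V\<lparr>carrier := carrier_vec n\<rparr>) = n"
    using dim_is_n by argo
  show "VectorSpace.subspace class_ring (carrier_vec n) V"
    using span_is_subspace[of "set (unit_vecs n)"]
    by (simp add: span_unit_vecs_is_carrier unit_vecs_carrier)
qed

text \<open>Makes the arbitrary bases quantified over in \<open>plucker_zero_locus\<close>
  accessible as leading columns of invertible matrices.\<close>

lemma basis_of_extends_to_invertible:
  fixes W :: "'a vec set"
  assumes W: "subspace_of_dim n d W" and b: "is_basis_of n W b"
  obtains g where "g \<in> carrier_mat n n" "det g \<noteq> 0" "take d (cols g) = b" "W = col_subspace n d g"
    "length b = d" "d \<le> n"
proof -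
  have sub: "VectorSpace.subspace class_ring W V" using W by simp
  interpret W: vectorspace class_ring "V\<lparr>carrier := W\<rparr>"
    using sub subspace_is_vs by simp
  have b': "distinct b" "set b \<subseteq> W" "lin_indpt (set b)" "span (set b) = W"
    using b subspace_basis_iff[OF sub] by (auto simp: is_basis_of_def)
  have len: "length b = d"
    using W W.dim_basis[of "set b"] b distinct_card[OF b'(1)] by (auto simp: is_basis_of_def)
  have "set b \<subseteq> carrier_vec n" using b'(2) subspace_carrier[OF sub] by auto
  then obtain cs where cs: "distinct (b @ cs)" "lin_indpt (set (b @ cs))" "set (b @ cs) \<subseteq> carrier_vec n"
    "length (b @ cs) = n"
    using lin_indpt_list_extends[OF subspace_carrier_vec(1) b'(1,3)] subspace_carrier_vec(2) by metis
  note inv = invertible_of_basis[OF cs]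
  have "W = col_subspace n d (mat_of_cols n (b @ cs))"
    using span_take_cols[OF inv(1), of d] inv(3) len cs(4) b'(4) by auto
  then show thesis
    using inv(3) len cs(4) by (intro that[OF inv(1,2)]) auto
qed

text \<open>Bases of the successive members are extended by appending vectors, so the prefixes found
  earlier keep spanning the smaller members.\<close>

lemma flag_adapted_invertible:
  fixes W :: "nat \<Rightarrow> 'a vec set"
  assumes W: "\<And>i. i \<in> {1..r} \<Longrightarrow> subspace_of_dim n (k i) (W i)"
    and chain: "\<And>i. i \<in> {1..<r} \<Longrightarrow> W i \<subseteq> W (Suc i)"
  shows "\<exists>g. g \<in> carrier_mat n n \<and> det g \<noteq> 0 \<and> (\<forall>i\<in>{1..r}. W i = col_subspace n (k i) g)"
proof -
  \<comment> \<open>For \<open>r = 0\<close> the bound \<open>{}\<close> forces the empty list,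
    which then lies in whatever first member follows.\<close>
  have "\<exists>bs. distinct bs \<and> lin_indpt (set bs) \<and> set bs \<subseteq> (if r = 0 then {} else W r) \<and>
    (\<forall>i\<in>{1..r}. k i \<le> length bs \<and> span (set (take (k i) bs)) = W i)"
    using W chain
  proof (induction r)
    case 0
    then show ?case by (auto intro!: exI[of _ "[]"] simp: lin_dep_def)
  next
    case (Suc r)
    from Suc.IH Suc.prems obtain bs where bs: "distinct bs" "lin_indpt (set bs)"
      "set bs \<subseteq> (if r = 0 then {} else W r)"
      "\<And>i. i \<in> {1..r} \<Longrightarrow> k i \<le> length bs \<and> span (set (take (k i) bs)) = W i"
      by auto
    have "set bs \<subseteq> W (Suc r)"
      using bs(3) Suc.prems(2)[of r] by (cases "r = 0") auto
    moreover have "VectorSpace.subspace class_ring (W (Suc r)) V"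
      and d: "vectorspace.dim class_ring (V\<lparr>carrier := W (Suc r)\<rparr>) = k (Suc r)"
      using Suc.prems(1)[of "Suc r"] by auto
    ultimately obtain cs where cs: "distinct (bs @ cs)" "lin_indpt (set (bs @ cs))"
      "set (bs @ cs) \<subseteq> W (Suc r)" "span (set (bs @ cs)) = W (Suc r)" "length (bs @ cs) = k (Suc r)"
      using lin_indpt_list_extends[of "W (Suc r)" bs] bs(1,2) by metis
    have "k i \<le> length (bs @ cs) \<and> span (set (take (k i) (bs @ cs))) = W i" if "i \<in> {1..Suc r}" for i
    proof (cases "i = Suc r")
      case True
      then show ?thesis using cs by simp
    next
      case False
      then show ?thesis using bs(4)[of i] that by auto
    qed
    then show ?case
      using cs by (intro exI[of _ "bs @ cs"]) auto
  qed
  then obtain bs where bs: "distinct bs" "lin_indpt (set bs)" "set bs \<subseteq> (if r = 0 then {} else W r)"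
    "\<And>i. i \<in> {1..r} \<Longrightarrow> k i \<le> length bs \<and> span (set (take (k i) bs)) = W i"
    by blast
  have "set bs \<subseteq> carrier_vec n"
    using bs(3) W[of r] subspace_carrier[of "W r"] by (cases "r = 0") auto
  then obtain cs where cs: "distinct (bs @ cs)" "lin_indpt (set (bs @ cs))" "set (bs @ cs) \<subseteq> carrier_vec n"
    "length (bs @ cs) = n"
    using lin_indpt_list_extends[OF subspace_carrier_vec(1) bs(1,2)] subspace_carrier_vec(2) by metis
  note inv = invertible_of_basis[OF cs]
  have "W i = col_subspace n (k i) (mat_of_cols n (bs @ cs))" if "i \<in> {1..r}" for i
    using span_take_cols[OF inv(1), of "k i"] inv(3) cs(4) bs(4)[OF that] by auto
  then show ?thesis
    using inv(1,2) by blast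
qed

text \<open>Both spaces have dimension \<open>d\<close>, so extending a basis of the smaller one to
  the larger one adds no vector.\<close>

lemma col_subspace_eqI:
  fixes g h :: "'a mat"
  assumes g: "g \<in> carrier_mat n n" "det g \<noteq> 0" and h: "h \<in> carrier_mat n n" "det h \<noteq> 0"
    and d: "d \<le> n" and le: "col_subspace n d g \<subseteq> col_subspace n d h"
  shows "col_subspace n d g = col_subspace n d h"
proof -
  note G = col_subspace_basis[OF g d] and H = col_subspace_basis[OF h d]
  let ?b = "take d (cols g)"
  have b: "distinct ?b" "set ?b \<subseteq> col_subspace n d g" "lin_indpt (set ?b)" "span (set ?b) = col_subspace n d g"
    using G(2) subspace_basis_iff[of "col_subspace n d g"] G(1) by (auto simp: is_basis_of_def)
  obtain cs where "span (set (?b @ cs)) = col_subspace n d h" "length (?b @ cs) = d"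
    using lin_indpt_list_extends[of "col_subspace n d h" ?b] H(1) b le by (metis order_trans)
  moreover have "length ?b = d" using g d by simp
  ultimately show ?thesis using b(4) by simp
qed

end

section \<open>Density of the orbit\<close>

text \<open>Flags are indexed from 1 and matrices from 0, hence the shift
  \<open>j - 1\<close>.\<close>

definition flags ::
    "nat \<Rightarrow> nat \<Rightarrow> (nat \<Rightarrow> nat) \<Rightarrow> nat \<Rightarrow> (nat \<Rightarrow> 'k::field mat) \<Rightarrow> nat \<Rightarrow> nat \<Rightarrow> 'k vec set" where
  "flags n r k m g = (\<lambda>j\<in>{1..m}. \<lambda>i\<in>{1..r}. col_subspace n (k i) (g (j - 1)))"

lemma flags_cong: "(\<And>j. j < m \<Longrightarrow> g j = h j) \<Longrightarrow> flags n r k m g = flags n r k m h"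
  unfolding flags_def by (intro restrict_ext) auto

lemma std_subspace_mono: "d \<le> d' \<Longrightarrow> std_subspace n d \<subseteq> std_subspace n d'"
  by (auto simp: std_subspace_def)

lemma col_subspace_mono: "d \<le> d' \<Longrightarrow> col_subspace n d g \<subseteq> col_subspace n d' g"
  unfolding col_subspace_def by (intro image_mono std_subspace_mono)

lemma col_subspace_mult:
  assumes "g \<in> carrier_mat n n" "h \<in> carrier_mat n n"
  shows "col_subspace n d (g * h) = (\<lambda>v. g *\<^sub>v v) ` col_subspace n d h"
  unfolding col_subspace_def image_image
  using assms by (intro image_cong) (auto simp: std_subspace_def)

text \<open>The zero entries of \<open>p\<close> give one inclusion, and equality follows because
  the dimensions agree.\<close>

lemma col_subspace_block_upper:
  assumes h: "h \<in> carrier_mat n n" "det h \<noteq> 0" and p: "block_upper n K p" "det p \<noteq> 0"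
    and d: "d \<in> K" "d \<le> n"
  shows "col_subspace n d (h * p) = col_subspace n d h"
proof (rule vec_space.col_subspace_eqI)
  have pc: "p \<in> carrier_mat n n" using p by (simp add: block_upper_def)
  show "h * p \<in> carrier_mat n n" "det (h * p) \<noteq> 0"
    using h pc p(2) by (auto simp: det_mult[OF h(1) pc])
  have "p *\<^sub>v v \<in> std_subspace n d" if v: "v \<in> std_subspace n d" for v
    unfolding std_subspace_def
  proof (intro CollectI conjI allI impI)
    have vc: "v \<in> carrier_vec n" using v by (simp add: std_subspace_def)
    show "p *\<^sub>v v \<in> carrier_vec n" using pc vc by auto
    fix a assume a: "a < n" "d \<le> a"
    have "p $$ (a, b) * v $ b = 0" if "b < n" for b
      using p(1) d(1) a v that by (cases "b < d") (auto simp: block_upper_def std_subspace_def)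
    then show "(p *\<^sub>v v) $ a = 0"
      unfolding sum_mult_mat_vec_index[OF pc vc a(1)] by (intro sum.neutral) auto
  qed
  then show "col_subspace n d (h * p) \<subseteq> col_subspace n d h"
    unfolding col_subspace_mult[OF h(1) pc] by (auto simp: col_subspace_def)
qed (use h d in auto)

lemma mat_vec_image_cancel:
  assumes "g \<in> carrier_mat n n" "det g \<noteq> 0" "W \<subseteq> carrier_vec n"
  shows "(\<lambda>v. mat_inv g *\<^sub>v v) ` (\<lambda>v. g *\<^sub>v v) ` W = W"
proof -
  have "mat_inv g *\<^sub>v (g *\<^sub>v v) = v" if "v \<in> W" for v
  proof -
    have v: "v \<in> carrier_vec n" using that assms(3) by auto
    have "mat_inv g *\<^sub>v (g *\<^sub>v v) = (mat_inv g * g) *\<^sub>v v"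
      by (rule assoc_mult_mat_vec[OF mat_inv_carrier[OF assms(1)] assms(1) v, symmetric])
    then show ?thesis using mat_inv(2)[OF assms(1,2)] v by simp
  qed
  then show ?thesis by (simp add: image_image)
qed

lemma col_subspace_carrier: "g \<in> carrier_mat n n \<Longrightarrow> col_subspace n d g \<subseteq> carrier_vec n"
  by (auto simp: col_subspace_def std_subspace_def)

section \<open>The projective linear group acting on column spans\<close>

lemma PGL_coset:
  fixes A :: "'k::field mat"
  assumes A: "A \<in> carrier_mat n n" "det A \<noteq> 0"
  shows "{c \<cdot>\<^sub>m A | c. c \<noteq> 0} \<in> carrier (PGL TYPE('k) n)"
proof -
  have "A \<in> carrier (GL TYPE('k) n)"
    using mat_inv[OF A] mat_inv_carrier[OF A(1)] A(1)
    by (auto simp: GL_def units_of_def Units_def ring_mat_def)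
  moreover have "{c \<cdot>\<^sub>m 1\<^sub>m n | c. c \<noteq> 0} #>\<^bsub>GL TYPE('k) n\<^esub> A = {c \<cdot>\<^sub>m A | c. c \<noteq> 0}"
  proof -
    have "c \<cdot>\<^sub>m 1\<^sub>m n * A = c \<cdot>\<^sub>m A" for c
      using A(1) by (simp add: mult_smult_assoc_mat[of _ n n _ n])
    then show ?thesis
      by (auto simp: r_coset_def GL_def units_of_def ring_mat_def)
  qed
  ultimately show ?thesis
    by (auto simp: PGL_def FactGroup_def RCOSETS_def)
qed

text \<open>A nonzero scalar can be moved past \<open>A\<close> and \<open>h\<close> onto the
  standard subspace, which it maps onto itself.\<close>

lemma pgl_image_coset:
  fixes A :: "'k::field mat"
  assumes A: "A \<in> carrier_mat n n" and h: "h \<in> carrier_mat n n"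
  shows "pgl_image {c \<cdot>\<^sub>m A | c. c \<noteq> 0} (col_subspace n d h) = (\<lambda>v. A *\<^sub>v v) ` col_subspace n d h"
proof -
  have smult_mat_vec: "(c \<cdot>\<^sub>m A) *\<^sub>v w = c \<cdot>\<^sub>v (A *\<^sub>v w)" if "w \<in> carrier_vec n" for c w
    using A that by (intro eq_vecI) (auto simp: scalar_prod_def sum_distrib_left mult.assoc)
  have "(\<lambda>v. (c \<cdot>\<^sub>m A) *\<^sub>v v) ` col_subspace n d h = (\<lambda>v. A *\<^sub>v v) ` col_subspace n d h"
    if c: "c \<noteq> 0" for c
  proof -
    have scale: "(\<lambda>v. c \<cdot>\<^sub>v v) ` std_subspace n d = (std_subspace n d :: 'k vec set)"
    proof (intro equalityI subsetI)
      fix v :: "'k vec" assume v: "v \<in> std_subspace n d"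
      then have "v = c \<cdot>\<^sub>v (inverse c \<cdot>\<^sub>v v)"
        using c by (auto simp: smult_smult_assoc)
      moreover have "inverse c \<cdot>\<^sub>v v \<in> std_subspace n d"
        using v by (auto simp: std_subspace_def)
      ultimately show "v \<in> (\<lambda>v. c \<cdot>\<^sub>v v) ` std_subspace n d" by blast
    qed (auto simp: std_subspace_def)
    have "(\<lambda>v. (c \<cdot>\<^sub>m A) *\<^sub>v v) ` col_subspace n d h = (\<lambda>v. A *\<^sub>v (h *\<^sub>v (c \<cdot>\<^sub>v v))) ` std_subspace n d"
      unfolding col_subspace_def image_image
    proof (intro image_cong refl)
      fix v :: "'k vec" assume "v \<in> std_subspace n d"
      then have v: "v \<in> carrier_vec n" by (simp add: std_subspace_def)
      then have hv: "h *\<^sub>v v \<in> carrier_vec n" using h by auto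
      show "(c \<cdot>\<^sub>m A) *\<^sub>v (h *\<^sub>v v) = A *\<^sub>v (h *\<^sub>v (c \<cdot>\<^sub>v v))"
        using mult_mat_vec[OF h v, of c] mult_mat_vec[OF A hv, of c] smult_mat_vec[OF hv] by simp
    qed
    also have "\<dots> = (\<lambda>v. A *\<^sub>v (h *\<^sub>v v)) ` (\<lambda>v. c \<cdot>\<^sub>v v) ` std_subspace n d"
      by (simp add: image_image)
    finally show ?thesis unfolding scale by (simp add: col_subspace_def image_image)
  qed
  then have "(\<lambda>v. B *\<^sub>v v) ` col_subspace n d h = (\<lambda>v. A *\<^sub>v v) ` col_subspace n d h"
    if "B \<in> {c \<cdot>\<^sub>m A | c. c \<noteq> 0}" for B
    using that by blast
  moreover have "{c \<cdot>\<^sub>m A | c. c \<noteq> 0} \<noteq> {}" by (auto intro: exI[of _ 1])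
  ultimately show ?thesis
    unfolding pgl_image_def by (simp only: UN_constant if_False cong: SUP_cong)
qed

locale flag_type =
  fixes n r m :: nat and k :: "nat \<Rightarrow> nat"
  assumes mono: "\<And>i. i \<in> {1..<r} \<Longrightarrow> k i \<le> k (Suc i)" and le: "\<And>i. i \<in> {1..r} \<Longrightarrow> k i \<le> n"
begin

lemma flags_in_flag_power:
  assumes g: "\<And>j. j < m \<Longrightarrow> g j \<in> carrier_mat n n" "\<And>j. j < m \<Longrightarrow> det (g j :: 'k::field mat) \<noteq> 0"
  shows "flags n r k m g \<in> flag_power n r k m"
proof -
  have "(\<lambda>i\<in>{1..r}. col_subspace n (k i) (g (j - 1))) \<in> flag_variety n r k" if "j \<in> {1..m}" for j
  proof -
    have "j - 1 < m" using that by auto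
    then have "subspace_of_dim n (k i) (col_subspace n (k i) (g (j - 1)))" if "i \<in> {1..r}" for i
      using vec_space.col_subspace_basis(1)[OF g le[OF that]] by blast
    moreover have "col_subspace n (k i) (g (j - 1)) \<subseteq> col_subspace n (k (Suc i)) (g (j - 1))"
      if "i \<in> {1..<r}" for i
      by (rule col_subspace_mono[OF mono[OF that]])
    ultimately show ?thesis
      by (simp add: flag_variety_def)
  qed
  then show ?thesis by (auto simp: flag_power_def flags_def)
qed

lemma flag_power_eq_flags:
  fixes F :: "nat \<Rightarrow> nat \<Rightarrow> 'k::field vec set"
  assumes F: "F \<in> flag_power n r k m"
  shows "\<exists>g. (\<forall>j<m. g j \<in> carrier_mat n n \<and> det (g j) \<noteq> 0) \<and> F = flags n r k m g"
proof -
  have "\<forall>j\<in>{..<m}. \<exists>g. g \<in> carrier_mat n n \<and> det g \<noteq> 0 \<and>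
      (\<forall>i\<in>{1..r}. F (Suc j) i = col_subspace n (k i) g)"
  proof
    fix j assume "j \<in> {..<m}"
    then have that: "j < m" by simp
    have "F (Suc j) \<in> flag_variety n r k"
      using F that by (auto simp: flag_power_def)
    then have flag: "(\<forall>i\<in>{1..r}. subspace_of_dim n (k i) (F (Suc j) i)) \<and>
        (\<forall>i\<in>{1..<r}. F (Suc j) i \<subseteq> F (Suc j) (Suc i))"
      unfolding flag_variety_def mem_Collect_eq by (rule conjunct2)
    note W = flag[THEN conjunct1, THEN bspec] and chain = flag[THEN conjunct2, THEN bspec]
    show "\<exists>g. g \<in> carrier_mat n n \<and> det g \<noteq> 0 \<and> (\<forall>i\<in>{1..r}. F (Suc j) i = col_subspace n (k i) g)"
      using vec_space.flag_adapted_invertible[where W = "F (Suc j)", OF W chain] .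
  qed
  from bchoice[OF this] obtain g where "\<forall>j\<in>{..<m}. g j \<in> carrier_mat n n \<and> det (g j) \<noteq> 0 \<and>
      (\<forall>i\<in>{1..r}. F (Suc j) i = col_subspace n (k i) (g j))" ..
  then have g: "g j \<in> carrier_mat n n \<and> det (g j) \<noteq> 0 \<and>
      (\<forall>i\<in>{1..r}. F (Suc j) i = col_subspace n (k i) (g j))" if "j < m" for j
    using that by blast
  have "F = flags n r k m g"
  proof
    fix j show "F j = flags n r k m g j"
    proof (cases "j \<in> {1..m}")
      case True
      then have "F j \<in> extensional {1..r}"
        using F by (auto simp: flag_power_def flag_variety_def)
      moreover have "F j i = col_subspace n (k i) (g (j - 1))" if "i \<in> {1..r}" for i
        using g[of "j - 1"] True that by auto
      ultimately show ?thesis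
        using True by (auto simp: flags_def extensional_def fun_eq_iff)
    next
      case False
      then show ?thesis
        using PiE_arb[OF F[unfolded flag_power_def] False] by (simp only: flags_def restrict_apply if_False)
    qed
  qed
  with g show ?thesis by blast
qed

text \<open>In A g_j = h_j p_j the factor p_j does not change the spans, so the flag of g_j is the
  image under A^-1 of the flag of h_j. The group element is the class of A^-1.\<close>

lemma same_orbit_imp_flags_in_orbit:
  fixes g h :: "nat \<Rightarrow> 'k::field mat"
  assumes g: "\<And>j. j < m \<Longrightarrow> g j \<in> carrier_mat n n" "\<And>j. j < m \<Longrightarrow> det (g j) \<noteq> 0"
    and h: "\<And>j. j < m \<Longrightarrow> h j \<in> carrier_mat n n" "\<And>j. j < m \<Longrightarrow> det (h j) \<noteq> 0"
    and so: "same_orbit n (k ` {1..r}) m g h"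
  shows "flags n r k m g \<in> orbit (PGL TYPE('k) n) (diagonal_action n r k m) (flags n r k m h)"
proof -
  obtain A p where A: "A \<in> carrier_mat n n" "det A \<noteq> 0"
    and p: "\<And>j. j < m \<Longrightarrow> block_upper n (k ` {1..r}) (p j)" "\<And>j. j < m \<Longrightarrow> A * g j = h j * p j"
    using so by (auto simp: same_orbit_def)
  note Ai = mat_inv_carrier[OF A(1)]
  let ?c = "{c \<cdot>\<^sub>m mat_inv A | c. c \<noteq> 0}"
  have eq: "col_subspace n (k i) (g j) = pgl_image ?c (col_subspace n (k i) (h j))"
    if j: "j < m" and i: "i \<in> {1..r}" for i j
  proof -
    have pc: "p j \<in> carrier_mat n n" using p(1)[OF j] by (simp add: block_upper_def)
    have "det (h j) * det (p j) = det A * det (g j)"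
      using arg_cong[OF p(2)[OF j], of det] det_mult[OF A(1) g(1)[OF j]] det_mult[OF h(1)[OF j] pc]
      by simp
    then have "det (p j) \<noteq> 0" using A(2) g(2)[OF j] by auto
    then have "col_subspace n (k i) (h j) = col_subspace n (k i) (A * g j)"
      using col_subspace_block_upper[OF h(1)[OF j] h(2)[OF j] p(1)[OF j]] i le p(2)[OF j] by auto
    then have "pgl_image ?c (col_subspace n (k i) (h j)) =
        (\<lambda>v. mat_inv A *\<^sub>v v) ` (\<lambda>v. A *\<^sub>v v) ` col_subspace n (k i) (g j)"
      unfolding pgl_image_coset[OF Ai h(1)[OF j]] col_subspace_mult[OF A(1) g(1)[OF j], symmetric] by simp
    then show ?thesis
      using mat_vec_image_cancel[OF A col_subspace_carrier[OF g(1)[OF j]]] by simp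
  qed
  have "diagonal_action n r k m ?c (flags n r k m h) =
      (\<lambda>j\<in>{1..m}. \<lambda>i\<in>{1..r}. pgl_image ?c (flags n r k m h j i))"
    using flags_in_flag_power[OF h] by (simp add: diagonal_action_def)
  also have "\<dots> = flags n r k m g"
    unfolding flags_def by (intro restrict_ext) (auto simp: eq)
  finally have "flags n r k m g = diagonal_action n r k m ?c (flags n r k m h)" ..
  then show ?thesis
    using PGL_coset[OF Ai det_mat_inv[OF A]] by (auto simp: orbit_def)
qed

section \<open>Pluecker coordinates and Zariski open sets along curves\<close>

text \<open>Each coordinate is a minor with \<open>k i\<close> rows and columns, hence the
  determinant of a regular curve. The matrices may depend on \<open>i\<close>, because the bases
  chosen for different members of one flag need not be nested.\<close>

lemma plucker_eval_regular:
  assumes p: "\<And>\<mu>. \<mu> \<in> Poly_Mapping.keys p \<Longrightarrow> Poly_Mapping.keys \<mu> \<subseteq> plucker_indices n r k m"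
    and G: "\<And>j i. j \<in> {1..m} \<Longrightarrow> i \<in> {1..r} \<Longrightarrow> regular_mat_curve n n (\<lambda>t. G t j i)"
    and b: "\<And>t j i. j \<in> {1..m} \<Longrightarrow> i \<in> {1..r} \<Longrightarrow> b t j i = take (k i) (cols (G t j i))"
  shows "regular_rational (\<lambda>t. plucker_eval p (plucker_coords n (b t)))"
proof -
  have "regular_rational (\<lambda>t. plucker_coords n (b t) v)" if "v \<in> plucker_indices n r k m" for v
  proof -
    obtain j i S where v: "v = (j, i, S)" by (cases v)
    with that have ji: "j \<in> {1..m}" "i \<in> {1..r}" and S: "S \<subseteq> {..<n}" "card S = k i"
      by (auto simp: plucker_indices_def)
    let ?M = "\<lambda>t. mat_of_cols n (b t j i)"
    have car: "G t j i \<in> carrier_mat n n" for t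
      using regular_mat_curve_carrier[OF G[OF ji]] .
    have len: "length (b t j i) = k i" for t
      using car[of t] le[OF ji(2)] by (simp add: b[OF ji])
    have rows: "{a. a < n \<and> a \<in> S} = S" using S by auto
    have colsn: "{a. a < k i \<and> a \<in> UNIV} = {..<k i}" by auto
    have "regular_mat_curve (k i) (k i) (\<lambda>t. submatrix (?M t) S UNIV)"
      unfolding regular_mat_curve_def
    proof (intro conjI allI impI)
      fix t show "submatrix (?M t) S UNIV \<in> carrier_mat (k i) (k i)"
        using rows S len[of t] by (intro carrier_matI) (simp_all add: dim_submatrix)
    next
      fix x y assume xy: "x < k i" "y < k i"
      have px: "pick S x < n"
        using xy S rows by (intro pick_le) simp
      have "submatrix (?M t) S UNIV $$ (x, y) = G t j i $$ (pick S x, y)" for t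
      proof -
        have "submatrix (?M t) S UNIV $$ (x, y) = ?M t $$ (pick S x, pick UNIV y)"
          using xy rows S len[of t] by (intro submatrix_index) simp_all
        also have "\<dots> = G t j i $$ (pick S x, y)"
          using px xy len[of t] car[of t] le[OF ji(2)]
          by (simp add: pick_UNIV mat_of_cols_index b[OF ji])
        finally show ?thesis .
      qed
      then show "regular_rational (\<lambda>t. submatrix (?M t) S UNIV $$ (x, y))"
        using regular_mat_curve_index[OF G[OF ji] px, of y] xy le[OF ji(2)] by simp
    qed
    then show ?thesis
      using regular_rational_det by (simp add: v plucker_coords_def)
  qed
  note coord = this
  show ?thesis
    unfolding plucker_eval_def
    by (intro regular_rational_sum regular_rational_mult regular_rational_const
        regular_rational_prod regular_rational_power coord) (use p in blast)
qed

text \<open>Unions and finite intersections pass to the eventual statement, which leaves the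
  generating sets. Being outside a zero locus at \<open>0\<close> means that one family of bases
  gives a nonzero value; carrying that very family along the curve avoids comparing the values for
  different bases.\<close>

lemma zariski_open_eventually:
  fixes \<gamma> :: "'k::field \<Rightarrow> nat \<Rightarrow> 'k mat"
  assumes U: "openin (zariski n r k m) U"
    and \<gamma>: "\<And>j. j < m \<Longrightarrow> regular_mat_curve n n (\<lambda>t. \<gamma> t j)" "\<And>j. j < m \<Longrightarrow> det (\<gamma> 0 j) \<noteq> 0"
    and 0: "flags n r k m (\<gamma> 0) \<in> U"
  shows "\<forall>\<^sub>F t in cofinite. flags n r k m (\<gamma> t) \<in> U"
proof -
  have "generate_topology_on {flag_power n r k m - plucker_zero_locus n r k m p | p. multihomogeneous n r k m p} U"
    using U by (simp add: zariski_def openin_topology_generated_by_iff)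
  then show ?thesis using 0
  proof induction
    case (Int a b)
    then show ?case by (auto intro: eventually_conj)
  next
    case (UN K)
    then obtain a where a: "a \<in> K" "flags n r k m (\<gamma> 0) \<in> a" by auto
    from UN.IH[OF a] show ?case by eventually_elim (use a in auto)
  next
    case (Basis S)
    then obtain p where p: "multihomogeneous n r k m p" and S: "S = flag_power n r k m - plucker_zero_locus n r k m p"
      by auto
    have car: "\<gamma> t j \<in> carrier_mat n n" if "j < m" for t j
      using regular_mat_curve_carrier[OF \<gamma>(1)[OF that]] .
    from Basis S have "flags n r k m (\<gamma> 0) \<in> flag_power n r k m" "flags n r k m (\<gamma> 0) \<notin> plucker_zero_locus n r k m p"
      by auto
    then obtain b where b: "\<And>j i. j \<in> {1..m} \<Longrightarrow> i \<in> {1..r} \<Longrightarrow> is_basis_of n (flags n r k m (\<gamma> 0) j i) (b j i)"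
      and nz: "plucker_eval p (plucker_coords n b) \<noteq> 0"
      unfolding plucker_zero_locus_def by blast
    \<comment> \<open>The given basis is a constant column operation away from the leading columns
      of the curve at \<open>0\<close>. Because \<open>T\<close> preserves the standard subspace,
      the same operation yields a basis of the moving subspace whenever the curve is
      invertible.\<close>
    have "\<exists>T. T \<in> carrier_mat n n \<and> det T \<noteq> 0 \<and> b j i = take (k i) (cols (\<gamma> 0 (j - 1) * T)) \<and>
        (\<lambda>v. T *\<^sub>v v) ` std_subspace n (k i) = std_subspace n (k i)"
      if ji: "j \<in> {1..m}" "i \<in> {1..r}" for j i
    proof -
      let ?g = "\<gamma> 0 (j - 1)"
      have j1: "j - 1 < m" using ji by auto
      note g = car[OF j1, of 0] and gd = \<gamma>(2)[OF j1] and gi = mat_inv_carrier[OF car[OF j1, of 0]]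
      have F: "flags n r k m (\<gamma> 0) j i = col_subspace n (k i) ?g"
        using ji by (simp add: flags_def)
      obtain h where h: "h \<in> carrier_mat n n" "det h \<noteq> 0" "take (k i) (cols h) = b j i"
        "col_subspace n (k i) ?g = col_subspace n (k i) h"
        using vec_space.basis_of_extends_to_invertible[where n = n and d = "k i" and W = "col_subspace n (k i) ?g" and b = "b j i"]
          vec_space.col_subspace_basis(1)[OF g gd le[OF ji(2)]] b[OF ji] F by metis
      define T where "T = mat_inv ?g * h"
      have T: "T \<in> carrier_mat n n" unfolding T_def using gi h(1) by (rule mult_carrier_mat)
      have gT: "?g * T = h"
        unfolding T_def assoc_mult_mat[OF g gi h(1), symmetric] mat_inv(1)[OF g gd] using h(1) by simp
      have std: "std_subspace n (k i) \<subseteq> carrier_vec n" "(\<lambda>v. T *\<^sub>v v) ` std_subspace n (k i) \<subseteq> carrier_vec n"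
        using T by (auto simp: std_subspace_def)
      have "(\<lambda>v. ?g *\<^sub>v v) ` (\<lambda>v. T *\<^sub>v v) ` std_subspace n (k i) = (\<lambda>v. ?g *\<^sub>v v) ` std_subspace n (k i)"
        using col_subspace_mult[OF g T, of "k i"] h(4) unfolding gT by (simp add: col_subspace_def)
      then have "(\<lambda>v. T *\<^sub>v v) ` std_subspace n (k i) = std_subspace n (k i)"
        using mat_vec_image_cancel[OF g gd std(1)] mat_vec_image_cancel[OF g gd std(2)] by metis
      moreover have "det T \<noteq> 0"
        unfolding T_def det_mult[OF gi h(1)] using h(2) det_mat_inv[OF g gd] by simp
      ultimately show ?thesis using T gT h(3) by auto
    qed
    then obtain T where T: "\<And>j i. j \<in> {1..m} \<Longrightarrow> i \<in> {1..r} \<Longrightarrow>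
        T j i \<in> carrier_mat n n \<and> det (T j i) \<noteq> 0 \<and> b j i = take (k i) (cols (\<gamma> 0 (j - 1) * T j i)) \<and>
        (\<lambda>v. T j i *\<^sub>v v) ` std_subspace n (k i) = std_subspace n (k i)"
      by metis
    \<comment> \<open>Outside the index range the old values are kept, so that
      \<open>c 0 = b\<close> holds as an equation of functions.\<close>
    define c where "c = (\<lambda>t j i. if j \<in> {1..m} \<and> i \<in> {1..r} then take (k i) (cols (\<gamma> t (j - 1) * T j i)) else b j i)"
    have c0: "c 0 = b"
      using T by (auto simp: c_def fun_eq_iff)
    have "regular_rational (\<lambda>t. plucker_eval p (plucker_coords n (c t)))"
    proof (rule plucker_eval_regular[where G = "\<lambda>t j i. \<gamma> t (j - 1) * T j i"])
      show "Poly_Mapping.keys \<mu> \<subseteq> plucker_indices n r k m" if "\<mu> \<in> Poly_Mapping.keys p" for \<mu>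
        using p that unfolding multihomogeneous_def by metis
      show "regular_mat_curve n n (\<lambda>t. \<gamma> t (j - 1) * T j i)" if "j \<in> {1..m}" "i \<in> {1..r}" for j i
      proof -
        have "j - 1 < m" using that by auto
        then show ?thesis
          using \<gamma>(1) T[OF that] by (intro regular_mat_curve_mult[of n n] regular_mat_curve_const) auto
      qed
    qed (simp add: c_def)
    then have "\<forall>\<^sub>F t in cofinite. plucker_eval p (plucker_coords n (c t)) \<noteq> 0"
      by (rule regular_rational_eventually_nonzero) (use nz in \<open>simp add: c0\<close>)
    moreover have "\<forall>\<^sub>F t in cofinite. \<forall>j\<in>{..<m}. det (\<gamma> t j) \<noteq> 0"
      using \<gamma> by (intro eventually_ball_finite ballI regular_mat_curve_eventually_invertible) auto
    ultimately show ?case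
    proof eventually_elim
      case (elim t)
      have "is_basis_of n (flags n r k m (\<gamma> t) j i) (c t j i)" if ji: "j \<in> {1..m}" "i \<in> {1..r}" for j i
      proof -
        have j1: "j - 1 < m" using ji by auto
        have Tc: "T j i \<in> carrier_mat n n" "det (T j i) \<noteq> 0"
          "(\<lambda>v. T j i *\<^sub>v v) ` std_subspace n (k i) = std_subspace n (k i)"
          using T[OF ji] by auto
        note gc = car[OF j1, of t]
        have gT: "\<gamma> t (j - 1) * T j i \<in> carrier_mat n n" "det (\<gamma> t (j - 1) * T j i) \<noteq> 0"
          using mult_carrier_mat[OF gc Tc(1)] det_mult[OF gc Tc(1)] Tc(2) elim j1 by auto
        have "col_subspace n (k i) (\<gamma> t (j - 1) * T j i) = col_subspace n (k i) (\<gamma> t (j - 1))"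
          unfolding col_subspace_mult[OF gc Tc(1)] by (simp only: col_subspace_def Tc(3))
        then have "flags n r k m (\<gamma> t) j i = col_subspace n (k i) (\<gamma> t (j - 1) * T j i)"
          using ji by (simp add: flags_def)
        then show ?thesis
          using vec_space.col_subspace_basis(2)[OF gT le[OF ji(2)]] ji by (simp add: c_def)
      qed
      moreover have "flags n r k m (\<gamma> t) \<in> flag_power n r k m"
        using elim car by (intro flags_in_flag_power) auto
      ultimately show ?case
        using elim(1) unfolding S plucker_zero_locus_def by blast
    qed
  qed simp
qed

text \<open>The constant polynomial 1 has an empty zero locus only because every member of every
  flag possesses a basis: a condition over all bases would otherwise hold vacuously.\<close>

lemma topspace_zariski: "topspace (zariski n r k m) = (flag_power n r k m :: (nat \<Rightarrow> nat \<Rightarrow> 'k::field vec set) set)"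
proof -
  let ?one = "Poly_Mapping.single 0 1 :: 'k plucker_poly"
  have "multihomogeneous n r k m ?one"
    unfolding multihomogeneous_def by (intro exI[of _ "\<lambda>_ _. 0"]) simp
  moreover have "F \<notin> plucker_zero_locus n r k m ?one" if F: "F \<in> flag_power n r k m" for F
  proof
    assume zero: "F \<in> plucker_zero_locus n r k m ?one"
    obtain g where g: "\<And>j. j < m \<Longrightarrow> g j \<in> carrier_mat n n" "\<And>j. j < m \<Longrightarrow> det (g j) \<noteq> 0"
      "F = flags n r k m g"
      using flag_power_eq_flags[OF F] by blast
    have "is_basis_of n (F j i) (take (k i) (cols (g (j - 1))))" if "j \<in> {1..m}" "i \<in> {1..r}" for j i
    proof -
      have "j - 1 < m" using that by auto
      then show ?thesis
        using vec_space.col_subspace_basis(2)[OF g(1,2) le] that by (simp add: g(3) flags_def)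
    qed
    with zero have "plucker_eval ?one (plucker_coords n (\<lambda>j i. take (k i) (cols (g (j - 1))))) = 0"
      by (auto simp: plucker_zero_locus_def)
    then show False by (simp add: plucker_eval_def)
  qed
  ultimately have "flag_power n r k m \<subseteq>
      \<Union>{flag_power n r k m - plucker_zero_locus n r k m p | p :: 'k plucker_poly. multihomogeneous n r k m p}"
    by blast
  then show ?thesis
    by (auto simp: zariski_def)
qed

end

section \<open>Density over an algebraically closed field\<close>

lemma infinite_UNIV_alg_closed: "infinite (UNIV :: 'k::alg_closed_field set)"
proof
  assume fin: "finite (UNIV :: 'k set)"
  \<comment> \<open>Over a finite field this polynomial vanishes everywhere, so \<open>p + 1\<close>
    would be nonconstant without a root.\<close>
  define p where "p = (\<Prod>a\<in>(UNIV :: 'k set). [:- a, 1:])"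
  have "degree p = card (UNIV :: 'k set)"
    unfolding p_def by (subst degree_prod_eq_sum_degree) auto
  then have "degree p > 0" using fin by (simp add: finite_UNIV_card_ge_0)
  then have "degree (p + 1) > 0"
    by (subst degree_add_eq_left) auto
  then obtain x where "poly (p + 1) x = 0"
    using alg_closed_imp_poly_has_root by blast
  moreover have "poly p x = 0"
    unfolding p_def poly_prod using fin by (intro prod_zero) auto
  ultimately show False by simp
qed

theorem corollary3p5:
  fixes m r n :: nat and k :: "nat \<Rightarrow> nat"
  assumes "m > 0" and "r > 0"
    and "0 < k 1" and "\<forall>i\<in>{1..<r}. k i < k (Suc i)" and "k r < n"
    and "k (r + 1) = n"
    and "\<forall>i\<in>{2..r + 1}. k i \<ge> (m - 1) * k (i - 1)"
  shows "dense_action (PGL TYPE('k::alg_closed_field) n) (diagonal_action n r k m)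
           (zariski n r k m) (flag_power n r k m)"
proof -
  obtain l where m: "m = Suc l" using assms(1) by (cases m) auto
  have grow: "l * k i \<le> k (Suc i)" if "i \<in> {1..r}" for i
    using assms(7)[rule_format, of "Suc i"] that m by auto
  have le: "k i \<le> n" if "i \<in> {1..r}" for i
  proof -
    have "i \<le> r" "1 \<le> i" using that by auto
    then have "k i \<le> k r"
    proof (induction i rule: inc_induct)
      case (step i)
      then show ?case using assms(4) by (auto intro: order_trans[OF less_imp_le])
    qed simp
    with assms(5) show ?thesis by simp
  qed
  interpret flag_type n r m k
    by unfold_locales (use assms(4) le in \<open>auto simp: less_imp_le\<close>)
  \<comment> \<open>Here \<open>l\<close> is \<open>m - 1\<close>, and the convention
    \<open>k (r + 1) = n\<close> turns the last growth inequality into the bound by the ambient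
    dimension.\<close>
  obtain h :: "nat \<Rightarrow> 'k mat" where gen: "generic_tuple n (k ` {1..r}) (Suc l) h"
    using generic_tuple_exists[of r k l n] assms(2,4) grow[of r] grow le[of r] assms(6)
    by (auto simp: less_imp_le)
  have h: "h j \<in> carrier_mat n n" "det (h j) \<noteq> 0" if "j < m" for j
    using gen that m by (auto simp: generic_tuple_def)
  let ?x = "flags n r k m h"
  let ?O = "orbit (PGL TYPE('k) n) (diagonal_action n r k m) ?x"
  have "F \<in> zariski n r k m closure_of ?O" if F: "F \<in> flag_power n r k m" for F
    unfolding in_closure_of topspace_zariski
  proof (intro conjI allI impI F)
    fix U assume U: "F \<in> U \<and> openin (zariski n r k m) U"
    obtain g where g: "\<And>j. j < m \<Longrightarrow> g j \<in> carrier_mat n n" "\<And>j. j < m \<Longrightarrow> det (g j) \<noteq> 0"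
      "F = flags n r k m g"
      using flag_power_eq_flags[OF F] by blast
    \<comment> \<open>The line from \<open>g\<close> at 0 to \<open>h\<close> at 1. Beyond
      \<open>m\<close> it is constantly \<open>h\<close>, since \<open>generic_tuple\<close>
      compares whole functions.\<close>
    define \<gamma> where "\<gamma> = (\<lambda>t j. if j < m
      then mat n n (\<lambda>(a, b). (1 - t) * g j $$ (a, b) + t * h j $$ (a, b)) else h j)"
    have sub: "regular_rational (\<lambda>t::'k. 1 - t)"
      using regular_rational_add[OF regular_rational_const regular_rational_mult[OF regular_rational_const regular_rational_id], of 1 "- 1"]
      by simp
    have reg: "regular_mat_curve n n (\<lambda>t. \<gamma> t j)" "regular_mat_curve n n (\<lambda>t. \<gamma> (1 - t) j)" if "j < m" for j
      using that sub unfolding \<gamma>_def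
      by (auto intro!: regular_mat_curve_mat regular_rational_add regular_rational_mult
          regular_rational_const regular_rational_id)
    have \<gamma>0: "\<gamma> 0 j = g j" if "j < m" for j
      using that g(1)[OF that] by (auto simp: \<gamma>_def)
    have \<gamma>1: "\<gamma> (1 - 0) = h"
    proof
      fix j show "\<gamma> (1 - 0) j = h j"
        using h(1)[of j] by (cases "j < m") (auto simp: \<gamma>_def)
    qed
    have "\<forall>\<^sub>F t in cofinite. flags n r k m (\<gamma> t) \<in> U"
      using U reg(1) \<gamma>0 g flags_cong[of m "\<gamma> 0" g n r k]
      by (intro zariski_open_eventually) auto
    moreover have "\<forall>\<^sub>F t in cofinite. \<forall>j\<in>{..<m}. det (\<gamma> t j) \<noteq> 0"
      using reg(1) \<gamma>0 g(2) by (intro eventually_ball_finite ballI regular_mat_curve_eventually_invertible) auto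
    moreover have "\<forall>\<^sub>F t in cofinite. same_orbit n (k ` {1..r}) m (\<gamma> t) h"
    proof -
      \<comment> \<open>Genericity speaks about curves that start at \<open>h\<close>, so the line
        is traversed backwards; the reflection sending t to 1 - t keeps the exceptional set
        finite.\<close>
      have "\<forall>\<^sub>F t in cofinite. same_orbit n (k ` {1..r}) m (\<gamma> (1 - t)) h"
        using gen[unfolded generic_tuple_def, THEN conjunct2, rule_format, of "\<lambda>t. \<gamma> (1 - t)"]
          reg(2) \<gamma>1 m by simp
      then have "finite ((\<lambda>t. 1 - t) ` {t. \<not> same_orbit n (k ` {1..r}) m (\<gamma> (1 - t)) h})"
        by (simp add: eventually_cofinite)
      moreover have "{t. \<not> same_orbit n (k ` {1..r}) m (\<gamma> t) h}
          \<subseteq> (\<lambda>t. 1 - t) ` {t. \<not> same_orbit n (k ` {1..r}) m (\<gamma> (1 - t)) h}"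
        by (auto intro!: image_eqI[of _ _ "1 - _"])
      ultimately show ?thesis
        unfolding eventually_cofinite by (rule rev_finite_subset)
    qed
    ultimately have "\<forall>\<^sub>F t in cofinite. flags n r k m (\<gamma> t) \<in> U \<and> flags n r k m (\<gamma> t) \<in> ?O"
    proof eventually_elim
      case (elim t)
      then show ?case
        using regular_mat_curve_carrier[OF reg(1)] h by (intro conjI same_orbit_imp_flags_in_orbit) auto
    qed
    \<comment> \<open>An eventual property has a witness because the field is infinite, which makes
      the cofinite filter nontrivial.\<close>
    then have "\<exists>t. flags n r k m (\<gamma> t) \<in> U \<and> flags n r k m (\<gamma> t) \<in> ?O"
      using infinite_UNIV_alg_closed[where 'k = 'k]
      by (intro eventually_happens'[where F = cofinite]) simp
    then show "\<exists>y. y \<in> ?O \<and> y \<in> U" by blast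
  qed
  moreover have "zariski n r k m closure_of ?O \<subseteq> flag_power n r k m"
    using closure_of_subset_topspace topspace_zariski by metis
  ultimately have "zariski n r k m closure_of ?O = flag_power n r k m" by blast
  moreover have "?x \<in> flag_power n r k m"
    using h by (intro flags_in_flag_power) auto
  ultimately show ?thesis
    unfolding dense_action_def by blast
qed

end
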